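(* Let $\mathcal{S}$ be a stationary quantum stochastic source with alphabet of $N$ pure states $\ket{s_1},\dots,\ket{s_N}$ spanning a $d$-dimensional Hilbert space $\mathcal{H}$. For positive integers $m,l$, let $\rho_l=\sum_{i=1}^{d^l}\lambda_i\ket{\lambda_i}\bra{\lambda_i}$ be a spectral decomposition (with $(\ket{\lambda_i})_{i=1}^{d^l}$ an orthonormal basis of $\mathcal{H}^{\otimes l}$) of the ensemble state of $l$ emissions, let $(\omega_i)_{i=1}^{d^l}$ be the bit strings of a binary Huffman code for the probability distribution $(\lambda_i)_{i=1}^{d^l}$, and let $V=\sum_{i=1}^{d^l}\ket{\omega_i}\bra{\lambda_i}:\mathcal{H}^{\otimes l}\to(\mathbb{C}^2)^{\oplus}$. Then the constrained special block code $\mathcal{V}$ which uses the same isometry $V$ on each of the $m$ blocks is a minimizer, i.e. $L(\mathcal{V})=ILC(\mathcal{S},m,l)$. Moreover, the minimum average codeword length per symbol equals the von Neumann entropy rate of the source for asymptotically long block size: $$\lim_{l\to\infty}\frac{ILC(\mathcal{S},1,l)}{l}=\lim_{l\to\infty}\frac{S(\rho_l)}{l}.$$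
   Context: Pure states are unit vectors. $\mathbb{N}=\{1,2,\dots\}$. $S(\rho)=-\mathrm{Tr}(\rho\log_2\rho)$ is the von Neumann entropy. Quantum stochastic source: a finite list of pure states $\ket{s_1},\dots,\ket{s_N}$ spanning a $d$-dimensional Hilbert space $\mathcal{H}$ together with a stochastic process $X=(X_n)_{n\ge1}$ with values in $\{1,\dots,N\}$; at time $n$ the state $\ket{s_{X_n}}$ is emitted. Its mass function is $p(n_1,\dots,n_q)=\mathbb{P}(X_1=n_1,\dots,X_q=n_q)$. The source is stationary if $\mathbb{P}(X_1=n_1,\dots,X_q=n_q)=\mathbb{P}(X_{k+1}=n_1,\dots,X_{k+q}=n_q)$ for all $k,q\in\mathbb{N}$ and all $(n_1,\dots,n_q)\in\{1,\dots,N\}^q$. Write $\ket{s_{n_1}\cdots s_{n_q}}=\ket{s_{n_1}}\otimes\cdots\otimes\ket{s_{n_q}}$. The ensemble state of $l$ emissions is $\rho_l=\sum_{n_1,\dots,n_l=1}^N p(n_1,\dots,n_l)\ket{s_{n_1}\cdots s_{n_l}}\bra{s_{n_1}\cdots s_{n_l}}$. Fock space: $(\mathbb{C}^2)^{\oplus}=\bigoplus_{k=0}^\infty(\mathbb{C}^2)^{\otimes k}$ with $(\mathbb{C}^2)^{\otimes0}=\mathbb{C}$; its standard basis is the set of qubit strings $\ket{\omega}$, $\omega$ a finite bit string (including the empty string). A length codeword of length $\ell$ is a unit vector in $(\mathbb{C}^2)^{\otimes\ell}$ for some integer $\ell\ge 0$. Concatenation $\circ$ is defined on standard basis vectors by concatenating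 bit strings and extended multilinearly. A Huffman code for a one-symbol alphabet consists of the empty string. A sequence of unit vectors $(\ket{\psi_i})_{i=1}^D$ in $(\mathbb{C}^2)^{\oplus}$ is jointly orthonormal if for every $M\in\mathbb{N}$ the family $\ket{\psi_{v_1}\circ\cdots\circ\psi_{v_M}}$, indexed by $(v_1,\dots,v_M)\in\{1,\dots,D\}^M$, is orthonormal (distinct index tuples give orthogonal vectors). Constrained special block code (for $\mathcal{S}$, $m$ blocks, block size $l$): a family of isometries $\mathcal{U}=\{U_k\}_{k=1}^m$ from $\mathcal{H}^{\otimes l}$ to $(\mathbb{C}^2)^{\oplus}$ for which there are a single jointly orthonormal sequence of length codewords $(\ket{\psi_i})_{i=1}^{d^l}$ and, for each $k$, an orthonormal basis $(\ket{e_i^k})_{i=1}^{d^l}$ of $\mathcal{H}^{\otimes l}$ with $U_k=\sum_{i=1}^{d^l}\ket{\psi_i}\bra{e_i^k}$. Length observable: $\Lambda=\sum_{\ell=0}^\infty\ell\,\Pi_\ell$, with $\Pi_\ell$ the orthogonal projection of $(\mathbb{C}^2)^{\oplus}$ onto $(\mathbb{C}^2)^{\otimes\ell}$. Average codeword length of $\mathcal{U}=\{U_k\}_{k=1}^m$: $$L(\mathcal{U})=\sum_{n_1,\dots,n_{ml}=1}^N p(n_1,\dots,n_{ml})\,\mathrm{Tr}\big(\ket{x_{n_1,\dots,n_{ml}}}\bra{x_{n_1,\dots,n_{ml}}}\Lambda\big),$$ where $x_{n_1,\dots,n_{ml}}=U_1\ket{s_{n_1}\cdots s_{n_l}}\circ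 U_2\ket{s_{n_{l+1}}\cdots s_{n_{2l}}}\circ\cdots\circ U_m\ket{s_{n_{(m-1)l+1}}\cdots s_{n_{ml}}}$. $ILC(\mathcal{S},m,l)$ is the infimum of $L(\mathcal{U})$ over all constrained special block codes $\mathcal{U}$ for $\mathcal{S},m,l$. *)

theory Defs
  imports "HOL-Probability.Probability"
begin

section \<open>Fock spaces in coordinates\<close>

text \<open>
  A vector of the Fock space over the Hilbert space with orthonormal basis \<open>'a\<close> is given by its
  coordinates in the basis of kets \<open>|w\<rangle>\<close>, \<open>w\<close> a word over \<open>'a\<close>.  With \<open>'a = bool\<close> this is the
  Fock space of qubit strings; with \<open>'a = 'd\<close>, its degree-\<open>l\<close> part is the \<open>l\<close>-th tensor power of
  the \<open>CARD('d)\<close>-dimensional space \<open>complex ^ 'd\<close>, to which every Hilbert space of that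
  dimension is isometrically isomorphic.
\<close>

type_synonym 'a fock = "'a list \<Rightarrow> complex"

definition fock_space :: "'a fock set" where
  "fock_space = {f. (\<lambda>w. (cmod (f w))\<^sup>2) summable_on UNIV}"

definition tensor_power :: "nat \<Rightarrow> 'a fock set" where
  "tensor_power l = {f. \<forall>w. length w \<noteq> l \<longrightarrow> f w = 0}"

definition ket :: "'a list \<Rightarrow> 'a fock" where
  "ket w = (\<lambda>v. if v = w then 1 else 0)"

definition braket :: "'a fock \<Rightarrow> 'a fock \<Rightarrow> complex" where
  "braket f g = (\<Sum>\<^sub>\<infinity>w. cnj (f w) * g w)"

definition ketbra :: "'b fock \<Rightarrow> 'a fock \<Rightarrow> 'a fock \<Rightarrow> 'b fock" where
  "ketbra g e = (\<lambda>f w. g w * braket e f)"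

text \<open>
  Operators on a tensor power are regarded as operators on the whole Fock space, extended by zero,
  so that a single trace serves both spaces.
\<close>

definition op_trace :: "('a fock \<Rightarrow> 'a fock) \<Rightarrow> complex" where
  "op_trace A = (\<Sum>\<^sub>\<infinity>w. braket (ket w) (A (ket w)))"

definition isometry_on_tensor_power ::
    "nat \<Rightarrow> ('a fock \<Rightarrow> 'b fock) \<Rightarrow> bool" where
  "isometry_on_tensor_power l U \<longleftrightarrow>
     (\<forall>f\<in>tensor_power l. U f \<in> fock_space) \<and>
     (\<forall>f\<in>tensor_power l. \<forall>g\<in>tensor_power l. \<forall>a b.
        U (\<lambda>w. a * f w + b * g w) = (\<lambda>w. a * U f w + b * U g w)) \<and>
     (\<forall>f\<in>tensor_power l. \<forall>g\<in>tensor_power l. braket (U f) (U g) = braket f g)"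

definition orthonormal_basis :: "nat \<Rightarrow> (nat \<Rightarrow> 'a::finite fock) \<Rightarrow> bool" where
  "orthonormal_basis l e \<longleftrightarrow>
     (\<forall>i\<in>{1..CARD('a) ^ l}. e i \<in> tensor_power l) \<and>
     (\<forall>i\<in>{1..CARD('a) ^ l}. \<forall>j\<in>{1..CARD('a) ^ l}.
        braket (e i) (e j) = (if i = j then 1 else 0)) \<and>
     (\<forall>f\<in>tensor_power l. \<exists>c. f = (\<lambda>w. \<Sum>i = 1..CARD('a) ^ l. c i * e i w))"

text \<open>The bilinear extension of \<open>|u\<rangle> \<circ> |v\<rangle> = |uv\<rangle>\<close>: sum over all ways to cut \<open>w\<close> in two.\<close>

definition fock_concat :: "'a fock \<Rightarrow> 'a fock \<Rightarrow> 'a fock" where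
  "fock_concat f g = (\<lambda>w. \<Sum>k\<le>length w. f (take k w) * g (drop k w))"

definition fock_concat_list :: "'a fock list \<Rightarrow> 'a fock" where
  "fock_concat_list fs = foldr fock_concat fs (ket [])"

definition tensor_ket :: "(complex ^ 'a) list \<Rightarrow> 'a fock" where
  "tensor_ket vs =
     (\<lambda>w. if length w = length vs then \<Prod>i<length vs. (vs ! i) $ (w ! i) else 0)"


section \<open>Spectral decompositions and von Neumann entropy\<close>

definition spectral_decomposition ::
    "nat \<Rightarrow> ('a::finite fock \<Rightarrow> 'a fock) \<Rightarrow> (nat \<Rightarrow> real) \<Rightarrow> (nat \<Rightarrow> 'a fock) \<Rightarrow> bool" where
  "spectral_decomposition l A lam e \<longleftrightarrow>
     orthonormal_basis l e \<and>
     (\<forall>f\<in>tensor_power l.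
        A f = (\<lambda>w. \<Sum>i = 1..CARD('a) ^ l. of_real (lam i) * ketbra (e i) (e i) f w))"

text \<open>
  Functional calculus; the result does not depend on the chosen spectral decomposition.  Since
  \<open>log 2 0 = 0\<close>, the kernel of \<open>A\<close> contributes nothing to the entropy, as it should by the
  convention \<open>0 log 0 = 0\<close>.
\<close>

definition op_log2 :: "nat \<Rightarrow> ('a::finite fock \<Rightarrow> 'a fock) \<Rightarrow> 'a fock \<Rightarrow> 'a fock" where
  "op_log2 l A =
     (SOME B. \<exists>lam e. spectral_decomposition l A lam e \<and>
        B = (\<lambda>f w. \<Sum>i = 1..CARD('a) ^ l. of_real (log 2 (lam i)) * ketbra (e i) (e i) f w))"

definition von_neumann_entropy :: "nat \<Rightarrow> ('a::finite fock \<Rightarrow> 'a fock) \<Rightarrow> real" where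
  "von_neumann_entropy l A = - Re (op_trace (A \<circ> op_log2 l A))"


section \<open>Quantum stochastic sources\<close>

text \<open>Probability that the letters emitted at times \<open>k + 1, \<dots>, k + length ns\<close> are \<open>ns\<close>.\<close>

definition window_prob :: "'w measure \<Rightarrow> (nat \<Rightarrow> 'w \<Rightarrow> nat) \<Rightarrow> nat \<Rightarrow> nat list \<Rightarrow> real" where
  "window_prob M X k ns =
     measure M {\<omega> \<in> space M. \<forall>i<length ns. X (k + i + 1) \<omega> = ns ! i}"

abbreviation source_mass :: "'w measure \<Rightarrow> (nat \<Rightarrow> 'w \<Rightarrow> nat) \<Rightarrow> nat list \<Rightarrow> real" where
  "source_mass M X ns \<equiv> window_prob M X 0 ns"

definition quantum_source ::
    "'w measure \<Rightarrow> (nat \<Rightarrow> 'w \<Rightarrow> nat) \<Rightarrow> nat \<Rightarrow> (nat \<Rightarrow> complex ^ 'd) \<Rightarrow> bool" where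
  "quantum_source M X N s \<longleftrightarrow>
     prob_space M \<and>
     (\<forall>n\<ge>1. X n \<in> measurable M (count_space {1..N})) \<and>
     (\<forall>i\<in>{1..N}. norm (s i) = 1) \<and>
     vec.span (s ` {1..N}) = UNIV"

definition stationary_process :: "'w measure \<Rightarrow> (nat \<Rightarrow> 'w \<Rightarrow> nat) \<Rightarrow> nat \<Rightarrow> bool" where
  "stationary_process M X N \<longleftrightarrow>
     (\<forall>k\<ge>1. \<forall>q\<ge>1. \<forall>ns. length ns = q \<and> set ns \<subseteq> {1..N} \<longrightarrow>
        window_prob M X 0 ns = window_prob M X k ns)"

definition index_words :: "nat \<Rightarrow> nat \<Rightarrow> nat list set" where
  "index_words N q = {ns. length ns = q \<and> set ns \<subseteq> {1..N}}"

definition source_ket :: "(nat \<Rightarrow> complex ^ 'd) \<Rightarrow> nat list \<Rightarrow> 'd fock" where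
  "source_ket s ns = tensor_ket (map s ns)"

definition ensemble_state ::
    "'w measure \<Rightarrow> (nat \<Rightarrow> 'w \<Rightarrow> nat) \<Rightarrow> nat \<Rightarrow> (nat \<Rightarrow> complex ^ 'd) \<Rightarrow> nat \<Rightarrow>
     'd fock \<Rightarrow> 'd fock" where
  "ensemble_state M X N s l =
     (\<lambda>f w. \<Sum>ns\<in>index_words N l.
        of_real (source_mass M X ns) * ketbra (source_ket s ns) (source_ket s ns) f w)"


section \<open>Constrained special block codes\<close>

definition length_codeword :: "bool fock \<Rightarrow> bool" where
  "length_codeword f \<longleftrightarrow> (\<exists>n. f \<in> tensor_power n) \<and> braket f f = 1"

definition jointly_orthonormal :: "nat \<Rightarrow> (nat \<Rightarrow> bool fock) \<Rightarrow> bool" where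
  "jointly_orthonormal D \<psi> \<longleftrightarrow>
     (\<forall>i\<in>{1..D}. \<psi> i \<in> fock_space \<and> braket (\<psi> i) (\<psi> i) = 1) \<and>
     (\<forall>m\<ge>1. \<forall>v\<in>index_words D m. \<forall>v'\<in>index_words D m.
        braket (fock_concat_list (map \<psi> v)) (fock_concat_list (map \<psi> v')) =
          (if v = v' then 1 else 0))"

definition constrained_special_block_code ::
    "nat \<Rightarrow> nat \<Rightarrow> (nat \<Rightarrow> 'd::finite fock \<Rightarrow> bool fock) \<Rightarrow> bool" where
  "constrained_special_block_code m l U \<longleftrightarrow>
     (\<forall>k\<in>{1..m}. isometry_on_tensor_power l (U k)) \<and>
     (\<exists>\<psi>. jointly_orthonormal (CARD('d) ^ l) \<psi> \<and>
          (\<forall>i\<in>{1..CARD('d) ^ l}. length_codeword (\<psi> i)) \<and>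
          (\<forall>k\<in>{1..m}. \<exists>e. orthonormal_basis l e \<and>
             (\<forall>f\<in>tensor_power l.
                U k f = (\<lambda>w. \<Sum>i = 1..CARD('d) ^ l. ketbra (\<psi> i) (e i) f w))))"

definition length_proj :: "nat \<Rightarrow> bool fock \<Rightarrow> bool fock" where
  "length_proj n f = (\<lambda>w. if length w = n then f w else 0)"

definition length_observable :: "bool fock \<Rightarrow> bool fock" where
  "length_observable f = (\<lambda>w. \<Sum>\<^sub>\<infinity>n. of_nat n * length_proj n f w)"

definition encoded_ket ::
    "(nat \<Rightarrow> complex ^ 'd) \<Rightarrow> nat \<Rightarrow> nat \<Rightarrow> (nat \<Rightarrow> 'd fock \<Rightarrow> bool fock) \<Rightarrow>
     nat list \<Rightarrow> bool fock" where
  "encoded_ket s m l U ns =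
     fock_concat_list
       (map (\<lambda>k. U k (source_ket s (take l (drop ((k - 1) * l) ns)))) [1..<m + 1])"

definition avg_codeword_length ::
    "'w measure \<Rightarrow> (nat \<Rightarrow> 'w \<Rightarrow> nat) \<Rightarrow> nat \<Rightarrow> (nat \<Rightarrow> complex ^ 'd) \<Rightarrow> nat \<Rightarrow> nat \<Rightarrow>
     (nat \<Rightarrow> 'd fock \<Rightarrow> bool fock) \<Rightarrow> real" where
  "avg_codeword_length M X N s m l U =
     (\<Sum>ns\<in>index_words N (m * l).
        source_mass M X ns *
        Re (op_trace (ketbra (encoded_ket s m l U ns) (encoded_ket s m l U ns)
                        \<circ> length_observable)))"

definition ILC ::
    "'w measure \<Rightarrow> (nat \<Rightarrow> 'w \<Rightarrow> nat) \<Rightarrow> nat \<Rightarrow> (nat \<Rightarrow> complex ^ 'd::finite) \<Rightarrow> nat \<Rightarrow> nat \<Rightarrow>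
     real" where
  "ILC M X N s m l =
     (INF U\<in>{U. constrained_special_block_code m l U}. avg_codeword_length M X N s m l U)"


section \<open>Huffman codes\<close>

text \<open>
  \<open>huffman_code I p c\<close>: some run of Huffman's procedure on the symbols \<open>I\<close> with weights \<open>p\<close>
  yields the codewords \<open>c\<close>.  Ties and the bit labels are resolved arbitrarily.  In a merging step
  the least likely symbols \<open>i\<close> and \<open>j\<close> are replaced by one symbol, again called \<open>i\<close>, that carries
  their joint weight.
\<close>

inductive huffman_code :: "'i set \<Rightarrow> ('i \<Rightarrow> real) \<Rightarrow> ('i \<Rightarrow> bool list) \<Rightarrow> bool" where
  single: "c i = [] \<Longrightarrow> huffman_code {i} p c"
| merge: "\<lbrakk>finite I; i \<in> I; j \<in> I; i \<noteq> j;
     \<forall>k\<in>I - {i, j}. p i \<le> p k \<and> p j \<le> p k;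
     huffman_code (I - {j}) (p(i := p i + p j)) c';
     \<forall>k\<in>I - {i, j}. c k = c' k; c i = c' i @ [b]; c j = c' i @ [\<not> b]\<rbrakk>
   \<Longrightarrow> huffman_code I p c"

definition string_isometry ::
    "nat \<Rightarrow> (nat \<Rightarrow> bool list) \<Rightarrow> (nat \<Rightarrow> 'd::finite fock) \<Rightarrow> 'd fock \<Rightarrow> bool fock" where
  "string_isometry l c e = (\<lambda>f w. \<Sum>i = 1..CARD('d) ^ l. ketbra (ket (c i)) (e i) f w)"

end

theory Submission
  imports Defs
begin

text \<open>
  Because the concatenated codewords are orthonormal and have definite length, the average length
  of a code is the sum over the blocks \<open>k\<close> of the expected length of \<open>\<psi>\<^sub>i\<close> under the distribution
  \<open>q\<^sub>i = \<langle>e\<^sub>i\<^sup>k|\<rho>|e\<^sub>i\<^sup>k\<rangle>\<close>, where stationarity makes \<open>\<rho>\<close> the same for all blocks.  The codewords of a given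
  total length are orthonormal vectors in a space of dimension a power of 2, so McMillan's counting
  argument gives the Kraft inequality.  The distribution \<open>q\<close> is a doubly stochastic image of the
  eigenvalues of \<open>\<rho>\<close>, so assigning the lengths to the eigenvectors in the opposite order of the
  eigenvalues does not increase the cost, and then the Huffman code is optimal.  Gibbs' inequality
  and Shannon's code lengths bound the Huffman cost by the entropy up to 2 bits.  A product of codes
  for blocks of lengths \<open>a\<close> and \<open>b\<close> is a code for blocks of length \<open>a + b\<close>, so the minimal cost is
  subadditive in the block length, and Fekete's lemma yields the limit.
\<close>

subsection \<open>Huffman codes and the Kraft inequality\<close>

text \<open>The codewords need not be bit strings, so there is no code tree to reason about: a
  competing code enters only through its length function. Huffman optimality is therefore proved
  against arbitrary lengths satisfying Kraft's inequality, and the usual argument about sibling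
  leaves becomes an integrality argument on sums of powers of 1/2. The doubly stochastic comparison
  is handled by cutting the lengths into layers; each layer only asks for the smallest entries of a
  vector. The entropy is defined through a spectral decomposition picked by choice, so a spectral
  theorem for the ensemble state has to be proved before the entropy has a computable value.
  Subadditivity is shown for the minimal cost and not for the entropy, because for the cost it
  follows from a competing code. The entropy inherits the limit, as its gap to the cost stays
  bounded and is divided by \<open>l\<close>. One of the two bits of the gap is Shannon's rounding;
  the other pays for reserving half of the Kraft budget for eigenvectors with eigenvalue 0, which
  need codewords too.\<close>

text \<open>A merge undone turns one leaf of depth d into two of depth d + 1, which have the same
  total weight; so Kraft holds with equality. Finiteness of \<open>I\<close> is recorded for callers
  that only have the inductive predicate.\<close>

lemma huffman_code_kraft:
  assumes "huffman_code I p c"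
  shows "finite I \<and> (\<Sum>i\<in>I. (1/2::real) ^ length (c i)) = 1"
  using assms
proof induction
  case (single c i p)
  then show ?case by simp
next
  case (merge I i j p c' c b)
  define R where "R = I - {i, j}"
  have I: "I = insert i (insert j R)" "I - {j} = insert i R"
    and R: "finite R" "i \<notin> R" "j \<notin> R"
    using merge.hyps by (auto simp: R_def)
  have "(\<Sum>k\<in>R. (1/2::real) ^ length (c k)) = (\<Sum>k\<in>R. (1/2) ^ length (c' k))"
    using merge.hyps by (intro sum.cong) (auto simp: R_def)
  moreover have "(1/2::real) ^ length (c' i) + (\<Sum>k\<in>R. (1/2) ^ length (c' k)) = 1"
    using merge.IH R by (simp add: I(2))
  ultimately show ?case
    using merge.hyps(4,1) R merge.hyps(8,9) by (simp add: I(1))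
qed

text \<open>Every codeword extends that of the symbol it was merged into, so comparable codewords
  come from the same merged symbol. The only pair left is \<open>i\<close>, \<open>j\<close>, whose
  codewords have equal length and differ in the last bit. The case of empty \<open>x\<close> gives
  injectivity.\<close>

lemma huffman_code_prefix_free:
  assumes "huffman_code I p c"
  shows "\<forall>i\<in>I. \<forall>j\<in>I. \<forall>x. c j = c i @ x \<longrightarrow> i = j"
  using assms
proof induction
  case (single c i p)
  then show ?case by simp
next
  case (merge I i j p c' c b)
  show ?case
  proof (intro ballI allI impI, rule ccontr)
    fix k k' x assume k: "k \<in> I" "k' \<in> I" "c k' = c k @ x" "k \<noteq> k'"
    \<comment> \<open>\<open>r k\<close> is the symbol that represents \<open>k\<close> after the
      merge.\<close>
    define r where "r k = (if k = j then i else k)" for k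
    have split: "\<exists>y. c k = c' (r k) @ y" if "k \<in> I" for k
    proof (cases "k = i \<or> k = j")
      case True
      then show ?thesis using merge.hyps(8,9) by (auto simp: r_def)
    next
      case False
      then show ?thesis using merge.hyps(7) that by (simp add: r_def)
    qed
    have rI: "r k \<in> I - {j}" if "k \<in> I" for k
      using merge.hyps(2,4) that by (simp add: r_def)
    have IH: "\<And>a b y. a \<in> I - {j} \<Longrightarrow> b \<in> I - {j} \<Longrightarrow> c' b = c' a @ y \<Longrightarrow> a = b"
      using merge.IH by blast
    obtain y where y: "c k = c' (r k) @ y" using split k(1) by blast
    obtain y' where y': "c k' = c' (r k') @ y'" using split k(2) by blast
    have eq: "c' (r k') @ y' = c' (r k) @ (y @ x)" using y y' k by simp
    then obtain us where "c' (r k') = c' (r k) @ us \<or> c' (r k') @ us = c' (r k)"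
      by (auto simp: append_eq_append_conv2)
    then have "r k = r k'" using IH[OF rI rI] k by metis
    then have "{k, k'} = {i, j}" using k by (auto simp: r_def split: if_splits)
    then show False using k merge.hyps(8,9) by (auto simp: doubleton_eq_iff)
  qed
qed

text \<open>The claim about rates mentions no code, so a Huffman run has to be produced
  there.\<close>

lemma huffman_code_exists:
  assumes "finite I" "I \<noteq> {}"
  shows "\<exists>c. huffman_code I p c"
  using assms
proof (induction "card I" arbitrary: I p rule: less_induct)
  case less
  obtain i where i: "i \<in> I" "\<forall>k\<in>I. p i \<le> p k"
    using less.prems ex_min_if_finite[of "p ` I"] by (metis arg_min_if_finite(1) arg_min_least)
  show ?case
  proof (cases "I = {i}")
    case True
    then show ?thesis using huffman_code.single[of "\<lambda>_. []" i p] by auto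
  next
    case False
    then have "finite (I - {i})" "I - {i} \<noteq> {}" using i less.prems by auto
    then obtain j where j: "j \<in> I - {i}" "\<forall>k\<in>I - {i}. p j \<le> p k"
      by (metis arg_min_if_finite(1) arg_min_least)
    have "card (I - {j}) < card I" using less.prems j by (meson Diff_iff card_Diff1_less)
    then obtain c' where c': "huffman_code (I - {j}) (p(i := p i + p j)) c'"
      using less.hyps[of "I - {j}" "p(i := p i + p j)"] less.prems i j by fastforce
    define c where "c = c'(i := c' i @ [True], j := c' i @ [False])"
    have "huffman_code I p c"
      by (rule huffman_code.merge[OF less.prems(1) i(1) _ _ _ c'])
        (use i j in \<open>auto simp: c_def\<close>)
    then show ?thesis by blast
  qed
qed

lemma sum_insert_insert:
  assumes "finite R" "i \<notin> R" "j \<notin> R" "i \<noteq> j"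
  shows "sum f (insert i (insert j R)) = f i + f j + sum f R"
  using assms by (simp add: add.assoc)

text \<open>The lighter symbol \<open>i\<close> receives the longer length; the cost changes by
  \<open>(p i - p a) * (n a - n i)\<close>, which is at most 0.\<close>

lemma weighted_sum_swap_le:
  fixes p :: "'i \<Rightarrow> real" and n :: "'i \<Rightarrow> nat"
  assumes "finite I" "i \<in> I" "a \<in> I" "p i \<le> p a" "n i \<le> n a"
  shows "(\<Sum>k\<in>I. p k * n (Transposition.transpose i a k)) \<le> (\<Sum>k\<in>I. p k * n k)"
proof (cases "i = a")
  case False
  define R where "R = I - {i, a}"
  have I: "I = insert i (insert a R)" and R: "finite R" "i \<notin> R" "a \<notin> R"
    using assms by (auto simp: R_def)
  have eq: "(\<Sum>k\<in>R. p k * n (Transposition.transpose i a k)) = (\<Sum>k\<in>R. p k * n k)"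
    using R by (intro sum.cong) (auto simp: Transposition.transpose_def)
  have "(p i - p a) * (real (n a) - n i) \<le> 0"
    using assms by (intro mult_nonpos_nonneg) auto
  then show ?thesis
    unfolding I sum_insert_insert[OF R False] eq by (simp add: algebra_simps)
qed simp

lemma sum_comp_transpose:
  assumes "i \<in> I" "a \<in> I"
  shows "(\<Sum>k\<in>I. f (n (Transposition.transpose i a k))) = (\<Sum>k\<in>I. f (n k))"
  by (rule sum.reindex_bij_betw[of "Transposition.transpose i a" I I "\<lambda>k. f (n k)"])
     (use assms in \<open>simp add: bij_betw_transpose_iff\<close>)

text \<open>All summands are multiples of \<open>(1/2) ^ L\<close>, so a sum below 1 misses 1 by at
  least \<open>(1/2) ^ L\<close>.\<close>

lemma kraft_gap:
  fixes n :: "'i \<Rightarrow> nat"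
  assumes "finite R" "\<forall>k\<in>R. n k \<le> L" "(\<Sum>k\<in>R. (1/2::real) ^ n k) < 1"
  shows "(\<Sum>k\<in>R. (1/2::real) ^ n k) + (1/2) ^ L \<le> 1"
proof -
  have h: "(1/2::real) ^ n k * 2 ^ L = real (2 ^ (L - n k))" if "k \<in> R" for k
  proof -
    have "L = n k + (L - n k)" using assms that by simp
    then have "(2::real) ^ L = 2 ^ n k * 2 ^ (L - n k)" by (metis power_add)
    then show ?thesis by (simp add: power_one_over)
  qed
  have "(\<Sum>k\<in>R. (1/2::real) ^ n k) * 2 ^ L = real (\<Sum>k\<in>R. 2 ^ (L - n k))"
    by (simp add: sum_distrib_right h)
  moreover have "(\<Sum>k\<in>R. (1/2::real) ^ n k) * 2 ^ L < 1 * 2 ^ L"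
    using assms by (intro mult_strict_right_mono) auto
  ultimately have "real (\<Sum>k\<in>R. 2 ^ (L - n k)) < real (2 ^ L)" by simp
  then have "Suc (\<Sum>k\<in>R. 2 ^ (L - n k)) \<le> 2 ^ L" by linarith
  then have "real (Suc (\<Sum>k\<in>R. 2 ^ (L - n k))) \<le> real (2 ^ L)" using of_nat_le_iff by blast
  then have "(\<Sum>k\<in>R. (1/2::real) ^ n k) * 2 ^ L + 1 \<le> 2 ^ L"
    using \<open>(\<Sum>k\<in>R. (1/2::real) ^ n k) * 2 ^ L = _\<close> by simp
  moreover have "(1/2::real) ^ L * 2 ^ L = 1" by (simp add: power_one_over)
  ultimately have "((\<Sum>k\<in>R. (1/2::real) ^ n k) + (1/2) ^ L) * 2 ^ L \<le> 1 * 2 ^ L"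
    by (simp only: distrib_right mult_1)
  then show ?thesis by (rule mult_right_le_imp_le) simp
qed

text \<open>The longest length is moved to the lightest symbol \<open>i\<close>, the longest
  remaining one to \<open>j\<close>, and then \<open>i\<close> is shortened to the length of
  \<open>j\<close>. Kraft survives the shortening by integrality: without \<open>i\<close> the sum
  is below 1 and a multiple of \<open>(1/2) ^ n2 j\<close>, so there is room for one more such term.
  The common length is a successor so that the two symbols can be merged.\<close>

lemma kraft_equalise_least_likely_aux:
  fixes p :: "'i \<Rightarrow> real" and n :: "'i \<Rightarrow> nat"
  assumes "finite I" "i \<in> I" "j \<in> I" "i \<noteq> j" "\<forall>k\<in>I. p i \<le> p k" "\<forall>k\<in>I - {i}. p j \<le> p k"
    and "\<forall>k\<in>I. 0 \<le> p k" and kraft: "(\<Sum>k\<in>I. (1/2::real) ^ n k) \<le> 1"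
  obtains n' L where "n' i = Suc L" "n' j = Suc L" "(\<Sum>k\<in>I. (1/2::real) ^ n' k) \<le> 1"
    "(\<Sum>k\<in>I. p k * n' k) \<le> (\<Sum>k\<in>I. p k * n k)"
proof -
  have max: "\<exists>a\<in>S. \<forall>k\<in>S. f k \<le> f a" if "finite S" "S \<noteq> {}" for S and f :: "'i \<Rightarrow> nat"
  proof -
    have "Max (f ` S) \<in> f ` S" using that by (intro Max_in) auto
    then obtain a where "a \<in> S" "Max (f ` S) = f a" by blast
    then show ?thesis using that by (metis Max_ge finite_imageI imageI)
  qed
  obtain a where a: "a \<in> I" "\<forall>k\<in>I. n k \<le> n a" using max[of I n] assms(1,2) by blast
  define n1 where "n1 k = n (Transposition.transpose i a k)" for k
  have n1: "(\<Sum>k\<in>I. p k * n1 k) \<le> (\<Sum>k\<in>I. p k * n k)"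
    unfolding n1_def using assms(1,2,5) a by (intro weighted_sum_swap_le) auto
  have k1: "(\<Sum>k\<in>I. (1/2::real) ^ n1 k) \<le> 1"
    unfolding n1_def using kraft sum_comp_transpose[OF assms(2) a(1), of "\<lambda>m. (1/2::real) ^ m" n] by simp
  have m1: "n1 k \<le> n1 i" if "k \<in> I" for k
    using a that assms(2) by (auto simp: n1_def Transposition.transpose_def)
  obtain b where b: "b \<in> I - {i}" "\<forall>k\<in>I - {i}. n1 k \<le> n1 b" using max[of "I - {i}" n1] assms(1,3,4) by blast
  define n2 where "n2 k = n1 (Transposition.transpose j b k)" for k
  have n2: "(\<Sum>k\<in>I. p k * n2 k) \<le> (\<Sum>k\<in>I. p k * n1 k)"
    unfolding n2_def using assms(1,3,4,6) b by (intro weighted_sum_swap_le) auto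
  have k2: "(\<Sum>k\<in>I. (1/2::real) ^ n2 k) \<le> 1"
    unfolding n2_def using k1 sum_comp_transpose[OF assms(3), of b "\<lambda>m. (1/2::real) ^ m" n1] b by simp
  have m2: "n2 k \<le> n2 j" if "k \<in> I - {i}" for k
    using b that assms(3,4) by (auto simp: n2_def Transposition.transpose_def)
  have m2': "n2 j \<le> n2 i" using m1 b assms(2-4) by (auto simp: n2_def Transposition.transpose_def)
  define R where "R = I - {i}"
  have R: "finite R" "i \<notin> R" "I = insert i R" "j \<in> R" using assms by (auto simp: R_def)
  have sI: "(\<Sum>k\<in>I. f k) = f i + (\<Sum>k\<in>R. f k)" for f :: "'i \<Rightarrow> real"
    unfolding R(3) using R(1,2) by (rule sum.insert)
  have "(1/2::real) ^ n2 i > 0" by simp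
  then have "(\<Sum>k\<in>R. (1/2::real) ^ n2 k) < 1" using k2 unfolding sI by linarith
  then have gap: "(\<Sum>k\<in>R. (1/2::real) ^ n2 k) + (1/2) ^ n2 j \<le> 1"
    using R(1) m2 by (intro kraft_gap) (auto simp: R_def)
  define n3 where "n3 = n2(i := n2 j)"
  have s3: "(\<Sum>k\<in>R. f k (n3 k)) = (\<Sum>k\<in>R. f k (n2 k))" for f :: "'i \<Rightarrow> nat \<Rightarrow> real"
    using R by (intro sum.cong) (auto simp: n3_def)
  have k3: "(\<Sum>k\<in>I. (1/2::real) ^ n3 k) \<le> 1"
    using gap unfolding sI s3[of "\<lambda>_ m. (1/2) ^ m"] by (simp add: n3_def add.commute)
  have "p i * n2 j \<le> p i * n2 i" using assms m2' by (intro mult_left_mono) auto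
  then have n3: "(\<Sum>k\<in>I. p k * n3 k) \<le> (\<Sum>k\<in>I. p k * n2 k)"
    unfolding sI s3[of "\<lambda>k m. p k * m"] by (simp add: n3_def)
  \<comment> \<open>A length 0 for \<open>j\<close> would put 1 into the sum and another 1 into the
    term reserved for \<open>i\<close>, against \<open>gap\<close>.\<close>
  have "n2 j \<noteq> 0"
  proof
    assume "n2 j = 0"
    have "(1/2::real) ^ n2 j \<le> (\<Sum>k\<in>R. (1/2::real) ^ n2 k)"
      using R by (intro member_le_sum) auto
    then show False using gap unfolding \<open>n2 j = 0\<close> by simp
  qed
  then obtain L where "n2 j = Suc L" using not0_implies_Suc by blast
  then show thesis using that[of n3 L] assms(4) k3 n1 n2 n3 by (auto simp: n3_def)
qed

text \<open>The merge rule does not say which of \<open>i\<close> and \<open>j\<close> is lighter;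
  the claim is symmetric in them, so either can play the lightest symbol.\<close>

lemma kraft_equalise_least_likely:
  fixes p :: "'i \<Rightarrow> real" and n :: "'i \<Rightarrow> nat"
  assumes "finite I" "i \<in> I" "j \<in> I" "i \<noteq> j" "\<forall>k\<in>I - {i, j}. p i \<le> p k \<and> p j \<le> p k"
    and "\<forall>k\<in>I. 0 \<le> p k" and kraft: "(\<Sum>k\<in>I. (1/2::real) ^ n k) \<le> 1"
  obtains n' L where "n' i = Suc L" "n' j = Suc L" "(\<Sum>k\<in>I. (1/2::real) ^ n' k) \<le> 1"
    "(\<Sum>k\<in>I. p k * n' k) \<le> (\<Sum>k\<in>I. p k * n k)"
proof (cases "p i \<le> p j")
  case True
  show thesis
    by (rule kraft_equalise_least_likely_aux[of I i j p n]) (use assms True that in auto)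
next
  case False
  show thesis
    by (rule kraft_equalise_least_likely_aux[of I j i p n]) (use assms False that in auto)
qed

text \<open>Merging \<open>i\<close> and \<open>j\<close> lowers the cost by
  \<open>p i + p j\<close> on both sides: for the Huffman code by construction, for the competitor
  once its two lengths have been made equal.\<close>

theorem huffman_code_optimal:
  assumes "huffman_code I p c" "\<forall>i\<in>I. 0 \<le> p i" "(\<Sum>i\<in>I. (1/2::real) ^ n i) \<le> 1"
  shows "(\<Sum>i\<in>I. p i * length (c i)) \<le> (\<Sum>i\<in>I. p i * real (n i))"
  using assms
proof (induction arbitrary: n)
  case (single c i p)
  then show ?case by simp
next
  case (merge I i j p c' c b)
  obtain n' L where n': "n' i = Suc L" "n' j = Suc L" "(\<Sum>k\<in>I. (1/2::real) ^ n' k) \<le> 1"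
    "(\<Sum>k\<in>I. p k * n' k) \<le> (\<Sum>k\<in>I. p k * n k)"
    using kraft_equalise_least_likely[OF merge.hyps(1-5) merge.prems] by blast
  define R where "R = I - {i, j}"
  have I: "I = insert i (insert j R)" "I - {j} = insert i R"
    and R: "finite R" "i \<notin> R" "j \<notin> R"
    using merge.hyps(1-4) by (auto simp: R_def)
  have sI: "(\<Sum>k\<in>I. f k) = f i + f j + (\<Sum>k\<in>R. f k)" for f :: "'a \<Rightarrow> real"
    unfolding I(1) using R merge.hyps(4) by (rule sum_insert_insert)
  have sJ: "(\<Sum>k\<in>I - {j}. f k) = f i + (\<Sum>k\<in>R. f k)" for f :: "'a \<Rightarrow> real"
    unfolding I(2) using R(1,2) by (rule sum.insert)
  \<comment> \<open>Two siblings of length \<open>Suc L\<close> become one leaf of length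
    \<open>L\<close>, with the same Kraft sum.\<close>
  define n'' where "n'' = n'(i := L)"
  define q where "q = p(i := p i + p j)"
  have q: "q i = p i + p j" "\<And>k. k \<in> R \<Longrightarrow> q k = p k" using R by (auto simp: q_def)
  have n'': "n'' i = L" "\<And>k. k \<in> R \<Longrightarrow> n'' k = n' k" using R by (auto simp: n''_def)
  have c: "\<And>k. k \<in> R \<Longrightarrow> c k = c' k" using merge.hyps(7) by (simp add: R_def)
  have "(\<Sum>k\<in>I - {j}. (1/2::real) ^ n'' k) \<le> 1"
    using n'(3) unfolding sI sJ by (simp add: n'' n'(1,2))
  moreover have "\<forall>k\<in>I - {j}. 0 \<le> q k" using merge.prems(1) merge.hyps(2,3) by (auto simp: q_def)
  ultimately have "(\<Sum>k\<in>I - {j}. q k * length (c' k)) \<le> (\<Sum>k\<in>I - {j}. q k * n'' k)"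
    using merge.IH unfolding q_def by blast
  then have "(p i + p j) * length (c' i) + (\<Sum>k\<in>R. p k * length (c' k))
      \<le> (p i + p j) * L + (\<Sum>k\<in>R. p k * n' k)"
    unfolding sJ by (simp add: q n'')
  then have "(\<Sum>k\<in>I. p k * length (c k)) \<le> (\<Sum>k\<in>I. p k * n' k)"
    unfolding sI by (simp add: n'(1,2) c merge.hyps(8,9) algebra_simps)
  then show ?case using n'(4) by linarith
qed

section \<open>Rearrangement under doubly stochastic matrices\<close>

text \<open>Bathtub principle: \<open>A\<close> holds the smallest values, separated from the others
  by \<open>\<theta>\<close>, and fractional weights of the same mass cannot do better. With
  \<open>u\<close> the indicator of \<open>A\<close>, each
  \<open>(w j - u j) * (x j - \<theta>)\<close> is nonnegative, and the terms in
  \<open>\<theta>\<close> cancel in the sum.\<close>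

lemma sum_extreme_subset_le:
  fixes x w :: "'i \<Rightarrow> real"
  assumes "finite I" "A \<subseteq> I" "\<forall>j\<in>A. x j \<le> \<theta>" "\<forall>j\<in>I - A. \<theta> \<le> x j"
    and "\<forall>j\<in>I. 0 \<le> w j \<and> w j \<le> 1" "(\<Sum>j\<in>I. w j) = card A"
  shows "(\<Sum>j\<in>A. x j) \<le> (\<Sum>j\<in>I. w j * x j)"
proof -
  define u where "u j = (if j \<in> A then 1 else 0::real)" for j
  have u: "(\<Sum>j\<in>I. u j * f j) = (\<Sum>j\<in>A. f j)" for f
  proof -
    have "(\<Sum>j\<in>I. u j * f j) = (\<Sum>j\<in>I. if j \<in> A then f j else 0)"
      by (intro sum.cong) (auto simp: u_def)
    also have "\<dots> = (\<Sum>j\<in>A. f j)" using assms by (subst sum.inter_restrict[symmetric]) (auto simp: Int_absorb1)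
    finally show ?thesis .
  qed
  have "0 \<le> (\<Sum>j\<in>I. (w j - u j) * (x j - \<theta>))"
  proof (rule sum_nonneg)
    fix j assume "j \<in> I"
    then show "0 \<le> (w j - u j) * (x j - \<theta>)"
      using assms by (cases "j \<in> A") (auto simp: u_def intro: mult_nonpos_nonpos)
  qed
  also have "\<dots> = (\<Sum>j\<in>I. w j * x j) - (\<Sum>j\<in>I. u j * x j) - \<theta> * ((\<Sum>j\<in>I. w j) - (\<Sum>j\<in>I. u j * 1))"
    by (simp add: left_diff_distrib right_diff_distrib sum_subtractf sum_distrib_left mult.commute)
  finally show ?thesis using assms by (simp only: u) simp
qed

text \<open>Layer cake: \<open>n i\<close> counts the thresholds \<open>t < n i\<close>, and by
  \<open>anti\<close> every superlevel set \<open>A t\<close> gathers the smallest values of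
  \<open>x\<close>. On a layer, the sums of \<open>D i j\<close> over \<open>i\<close> in
  \<open>A t\<close> are weights between 0 and 1 of total mass \<open>card (A t)\<close>.\<close>

lemma antisorted_doubly_stochastic_le:
  fixes n :: "'i \<Rightarrow> nat" and x :: "'i \<Rightarrow> real"
  assumes I: "finite I" and anti: "\<forall>i\<in>I. \<forall>j\<in>I. n j < n i \<longrightarrow> x i \<le> x j"
    and D: "\<forall>i\<in>I. \<forall>j\<in>I. 0 \<le> D i j"
    and row: "\<forall>i\<in>I. (\<Sum>j\<in>I. D i j) = 1" and col: "\<forall>j\<in>I. (\<Sum>i\<in>I. D i j) = 1"
  shows "(\<Sum>i\<in>I. n i * x i) \<le> (\<Sum>i\<in>I. n i * (\<Sum>j\<in>I. D i j * x j))"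
proof -
  define B where "B = Max (insert 0 (n ` I))"
  define A where "A t = {i\<in>I. t < n i}" for t
  have layer: "(\<Sum>i\<in>I. n i * f i) = (\<Sum>t<B. \<Sum>i\<in>A t. f i)" for f :: "'i \<Rightarrow> real"
  proof -
    have "(\<Sum>t<B. \<Sum>i\<in>A t. f i) = (\<Sum>t<B. \<Sum>i\<in>I. if t < n i then f i else 0)"
      unfolding A_def by (intro sum.cong refl sum.inter_filter I)
    also have "\<dots> = (\<Sum>i\<in>I. \<Sum>t<B. if t < n i then f i else 0)" by (rule sum.swap)
    also have "\<dots> = (\<Sum>i\<in>I. n i * f i)"
    proof (rule sum.cong[OF refl])
      fix i assume "i \<in> I"
      then have "n i \<le> B" using I by (auto simp: B_def)
      then have "{t\<in>{..<B}. t < n i} = {..<n i}" by auto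
      then show "(\<Sum>t<B. if t < n i then f i else 0) = n i * f i"
        by (subst sum.inter_filter[symmetric]) auto
    qed
    finally show ?thesis by simp
  qed
  have "(\<Sum>i\<in>A t. x i) \<le> (\<Sum>i\<in>A t. \<Sum>j\<in>I. D i j * x j)" for t
  proof (cases "A t = {}")
    case False
    have fA: "finite (A t)" "A t \<subseteq> I" using I by (auto simp: A_def)
    \<comment> \<open>The largest value inside the layer separates it from the outside.\<close>
    define \<theta> where "\<theta> = Max (x ` A t)"
    have \<theta>: "\<forall>j\<in>A t. x j \<le> \<theta>" using fA by (auto simp: \<theta>_def)
    have "\<theta> \<in> x ` A t" unfolding \<theta>_def using fA False by (intro Max_in) auto
    then obtain i where i: "i \<in> I" "t < n i" "\<theta> = x i" by (auto simp: A_def)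
    have \<theta>': "\<forall>j\<in>I - A t. \<theta> \<le> x j"
    proof
      fix j assume "j \<in> I - A t"
      then have "j \<in> I" "n j < n i" using i(2) by (auto simp: A_def)
      then show "\<theta> \<le> x j" using anti i by blast
    qed
    have w: "\<forall>j\<in>I. 0 \<le> (\<Sum>i\<in>A t. D i j) \<and> (\<Sum>i\<in>A t. D i j) \<le> 1"
    proof
      fix j assume j: "j \<in> I"
      have "(\<Sum>i\<in>A t. D i j) \<le> (\<Sum>i\<in>I. D i j)"
        using fA I D j by (intro sum_mono2) auto
      then show "0 \<le> (\<Sum>i\<in>A t. D i j) \<and> (\<Sum>i\<in>A t. D i j) \<le> 1"
        using col j D fA by (auto intro!: sum_nonneg)
    qed
    have "(\<Sum>j\<in>I. \<Sum>i\<in>A t. D i j) = (\<Sum>i\<in>A t. \<Sum>j\<in>I. D i j)" by (rule sum.swap)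
    also have "\<dots> = card (A t)" using row fA by (simp add: subset_iff)
    finally have "(\<Sum>i\<in>A t. x i) \<le> (\<Sum>j\<in>I. (\<Sum>i\<in>A t. D i j) * x j)"
      using sum_extreme_subset_le[OF I fA(2) \<theta> \<theta>' w] by simp
    also have "\<dots> = (\<Sum>i\<in>A t. \<Sum>j\<in>I. D i j * x j)"
      by (simp add: sum_distrib_right) (rule sum.swap)
    finally show ?thesis .
  qed simp
  then show ?thesis unfolding layer by (rule sum_mono)
qed

text \<open>A bijection of least cost exists by finiteness. It is antisorted, since exchanging two
  values in the wrong order would strictly lower the cost, so the comparison for antisorted lengths
  applies to it.\<close>

lemma doubly_stochastic_rearrangement:
  fixes n :: "'a \<Rightarrow> nat" and x :: "'i \<Rightarrow> real"
  assumes fin: "finite I" "finite A" and card: "card I = card A"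
    and D: "\<forall>a\<in>A. \<forall>j\<in>I. 0 \<le> D a j"
    and row: "\<forall>a\<in>A. (\<Sum>j\<in>I. D a j) = 1" and col: "\<forall>j\<in>I. (\<Sum>a\<in>A. D a j) = 1"
  obtains \<pi> where "bij_betw \<pi> I A"
    "(\<Sum>i\<in>I. x i * n (\<pi> i)) \<le> (\<Sum>a\<in>A. n a * (\<Sum>j\<in>I. D a j * x j))"
proof -
  \<comment> \<open>Extensional functions, so that the bijections form a finite set.\<close>
  define S where "S = {\<pi> \<in> I \<rightarrow>\<^sub>E A. bij_betw \<pi> I A}"
  define C where "C \<pi> = (\<Sum>i\<in>I. x i * n (\<pi> i))" for \<pi>
  have "finite S" unfolding S_def using fin by (intro finite_subset[OF _ finite_PiE[of I "\<lambda>_. A"]]) auto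
  have S: "restrict \<pi> I \<in> S" if "bij_betw \<pi> I A" for \<pi>
    using that by (auto simp: S_def bij_betw_def inj_on_def)
  obtain \<pi>0 where "bij_betw \<pi>0 I A" using fin card finite_same_card_bij by blast
  then have "S \<noteq> {}" using S by blast
  then obtain \<pi> where \<pi>: "\<pi> \<in> S" "\<forall>\<sigma>\<in>S. C \<pi> \<le> C \<sigma>"
    using \<open>finite S\<close> by (metis arg_min_if_finite(1) arg_min_least)
  have bij: "bij_betw \<pi> I A" using \<pi> by (simp add: S_def)
  have anti: "\<forall>i\<in>I. \<forall>j\<in>I. n (\<pi> j) < n (\<pi> i) \<longrightarrow> x i \<le> x j"
  proof (intro ballI impI, rule ccontr)
    fix i j assume ij: "i \<in> I" "j \<in> I" "n (\<pi> j) < n (\<pi> i)" "\<not> x i \<le> x j"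
    then have "i \<noteq> j" by auto
    have "bij_betw (\<pi> \<circ> Transposition.transpose i j) I A"
      using bij ij by (intro bij_betw_trans[of _ I I]) (auto simp: bij_betw_transpose_iff)
    then have "C \<pi> \<le> C (restrict (\<pi> \<circ> Transposition.transpose i j) I)" using S \<pi> by blast
    also have "\<dots> = (\<Sum>k\<in>I. x k * n (\<pi> (Transposition.transpose i j k)))" by (simp add: C_def)
    finally have le: "C \<pi> \<le> \<dots>" .
    define R where "R = I - {i, j}"
    have I: "I = insert i (insert j R)" and R: "finite R" "i \<notin> R" "j \<notin> R"
      using ij(1,2) fin(1) by (auto simp: R_def)
    have sI: "(\<Sum>k\<in>I. f k) = f i + f j + (\<Sum>k\<in>R. f k)" for f :: "'i \<Rightarrow> real"
      unfolding I using R \<open>i \<noteq> j\<close> by (rule sum_insert_insert)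
    have eq: "(\<Sum>k\<in>R. x k * n (\<pi> (Transposition.transpose i j k))) = (\<Sum>k\<in>R. x k * n (\<pi> k))"
      using R by (intro sum.cong) (auto simp: Transposition.transpose_def)
    have "x i * n (\<pi> i) + x j * n (\<pi> j) \<le> x i * n (\<pi> j) + x j * n (\<pi> i)"
      using le unfolding C_def sI eq by simp
    moreover have "0 < (x i - x j) * (real (n (\<pi> i)) - n (\<pi> j))"
      using ij by (intro mult_pos_pos) auto
    ultimately show False by (simp add: algebra_simps)
  qed
  have \<pi>A: "\<pi> i \<in> A" if "i \<in> I" for i using bij that by (auto simp: bij_betw_def)
  have "(\<Sum>i\<in>I. n (\<pi> i) * x i) \<le> (\<Sum>i\<in>I. n (\<pi> i) * (\<Sum>j\<in>I. D (\<pi> i) j * x j))"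
    using D row col \<pi>A sum.reindex_bij_betw[OF bij, of "\<lambda>a. D a _"]
    by (intro antisorted_doubly_stochastic_le[OF fin(1) anti]) auto
  also have "\<dots> = (\<Sum>a\<in>A. n a * (\<Sum>j\<in>I. D a j * x j))"
    by (rule sum.reindex_bij_betw[OF bij])
  finally show thesis using that[OF bij] by (simp add: mult.commute)
qed

text \<open>In the application \<open>D a j\<close> is the squared overlap of a competing basis
  vector with an eigenvector. The two index sets have separate types because product bases are
  indexed by pairs.\<close>

lemma huffman_code_le_doubly_stochastic:
  fixes n :: "'a \<Rightarrow> nat" and p :: "'i \<Rightarrow> real"
  assumes huff: "huffman_code I p c" and p: "\<forall>i\<in>I. 0 \<le> p i"
    and A: "finite A" "card I = card A" and kraft: "(\<Sum>a\<in>A. (1/2::real) ^ n a) \<le> 1"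
    and D: "\<forall>a\<in>A. \<forall>j\<in>I. 0 \<le> D a j"
    and row: "\<forall>a\<in>A. (\<Sum>j\<in>I. D a j) = 1" and col: "\<forall>j\<in>I. (\<Sum>a\<in>A. D a j) = 1"
  shows "(\<Sum>i\<in>I. p i * length (c i)) \<le> (\<Sum>a\<in>A. n a * (\<Sum>j\<in>I. D a j * p j))"
proof -
  have "finite I" using huffman_code_kraft[OF huff] by blast
  from doubly_stochastic_rearrangement[OF this A D row col, of p n]
  obtain \<pi> where \<pi>: "bij_betw \<pi> I A"
    "(\<Sum>i\<in>I. p i * n (\<pi> i)) \<le> (\<Sum>a\<in>A. n a * (\<Sum>j\<in>I. D a j * p j))"
    by blast
  have "(\<Sum>i\<in>I. (1/2::real) ^ n (\<pi> i)) \<le> 1"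
    using kraft sum.reindex_bij_betw[OF \<pi>(1), of "\<lambda>a. (1/2::real) ^ n a"] by simp
  then show ?thesis using huffman_code_optimal[OF huff p, of "\<lambda>i. n (\<pi> i)"] \<pi>(2) by simp
qed

section \<open>Shannon entropy and Kraft lengths\<close>

text \<open>Gibbs' inequality against the subprobabilities \<open>(1/2) ^ n i\<close>, from ln y
  \<le> y - 1 with y the ratio of the two weights.\<close>

lemma entropy_le_kraft_cost:
  fixes p :: "'i \<Rightarrow> real" and n :: "'i \<Rightarrow> nat"
  assumes "finite I" "\<forall>i\<in>I. 0 \<le> p i" "(\<Sum>i\<in>I. p i) = 1" "(\<Sum>i\<in>I. (1/2::real) ^ n i) \<le> 1"
  shows "- (\<Sum>i\<in>I. p i * log 2 (p i)) \<le> (\<Sum>i\<in>I. p i * n i)"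
proof -
  have pt: "(p i - (1/2) ^ n i) / ln 2 \<le> p i * n i + p i * log 2 (p i)" if "i \<in> I" for i
  proof (cases "p i = 0")
    case False
    then have pi: "p i > 0" using assms that by force
    define y where "y = (1/2::real) ^ n i / p i"
    have y: "y > 0" using pi by (simp add: y_def)
    have "ln y = - (n i * ln 2) - ln (p i)"
      using pi by (simp add: y_def ln_div ln_realpow)
    moreover have "ln y \<le> y - 1" using y by (rule ln_le_minus_one)
    ultimately have "p i * (1 - y) \<le> p i * (n i * ln 2 + ln (p i))"
      using pi by (intro mult_left_mono) auto
    moreover have "p i * (1 - y) = p i - (1/2) ^ n i" using pi by (simp add: y_def field_simps)
    ultimately have "(p i - (1/2) ^ n i) / ln 2 \<le> (p i * (n i * ln 2 + ln (p i))) / ln 2"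
      by (intro divide_right_mono) auto
    also have "\<dots> = p i * n i + p i * log 2 (p i)" by (simp add: log_def field_simps)
    finally show ?thesis .
  qed simp
  have "0 \<le> ((\<Sum>i\<in>I. p i) - (\<Sum>i\<in>I. (1/2::real) ^ n i)) / ln 2" using assms by simp
  also have "\<dots> = (\<Sum>i\<in>I. (p i - (1/2) ^ n i) / ln 2)"
    by (metis (no_types) sum_subtractf sum_divide_distrib)
  also have "\<dots> \<le> (\<Sum>i\<in>I. p i * n i + p i * log 2 (p i))" using pt by (rule sum_mono)
  finally show ?thesis by (simp add: sum.distrib)
qed

text \<open>Half of the Kraft budget goes to the positive probabilities, each one bit longer than
  its rounded negative logarithm. The other half is shared by the zero probabilities, for which
  \<open>Suc (card I)\<close> is long enough because \<open>card I < 2 ^ card I\<close>.\<close>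

lemma kraft_cost_near_entropy:
  fixes p :: "'i \<Rightarrow> real"
  assumes I: "finite I" and p: "\<forall>i\<in>I. 0 \<le> p i" "(\<Sum>i\<in>I. p i) = 1"
  obtains n :: "'i \<Rightarrow> nat" where "(\<Sum>i\<in>I. (1/2::real) ^ n i) \<le> 1"
    "(\<Sum>i\<in>I. p i * n i) \<le> 2 - (\<Sum>i\<in>I. p i * log 2 (p i))"
proof -
  define n where "n i = (if p i = 0 then Suc (card I) else Suc (nat \<lceil>- log 2 (p i)\<rceil>))" for i
  have pos: "p i > 0" "log 2 (p i) \<le> 0" if "i \<in> I" "p i \<noteq> 0" for i
  proof -
    show "p i > 0" using p that by force
    moreover have "p i \<le> (\<Sum>i\<in>I. p i)" using I p that by (intro member_le_sum) auto
    ultimately show "log 2 (p i) \<le> 0" using p by simp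
  qed
  have "(1/2::real) ^ n i \<le> p i / 2 + (1/2) ^ Suc (card I)" if i: "i \<in> I" for i
  proof (cases "p i = 0")
    case False
    have "- log 2 (p i) \<le> real (nat \<lceil>- log 2 (p i)\<rceil>)" by linarith
    then have "2 powr - real (nat \<lceil>- log 2 (p i)\<rceil>) \<le> 2 powr (log 2 (p i))" by simp
    then have "2 powr - real (nat \<lceil>- log 2 (p i)\<rceil>) \<le> p i" using pos[OF i False] by simp
    moreover have "(1/2::real) ^ k = 2 powr - real k" for k
      by (simp add: powr_minus_divide powr_realpow power_one_over)
    ultimately have "(1/2::real) ^ nat \<lceil>- log 2 (p i)\<rceil> \<le> p i" by simp
    then have "(1/2::real) ^ n i \<le> p i / 2" by (simp add: n_def False)
    moreover have "(0::real) \<le> (1/2) ^ Suc (card I)" by simp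
    ultimately show ?thesis by linarith
  qed (simp add: n_def)
  then have "(\<Sum>i\<in>I. (1/2::real) ^ n i) \<le> (\<Sum>i\<in>I. p i / 2 + (1/2) ^ Suc (card I))"
    by (rule sum_mono)
  also have "\<dots> = 1/2 + real (card I) * (1/2) ^ Suc (card I)"
    using p by (simp add: sum.distrib sum_divide_distrib[symmetric])
  also have "\<dots> \<le> 1"
  proof -
    have "real (card I) < 2 ^ card I" by (metis less_exp of_nat_less_iff of_nat_numeral of_nat_power)
    then have "real (card I) * (1/2) ^ card I \<le> 1" by (simp add: power_one_over field_simps)
    then show ?thesis by simp
  qed
  finally have k: "(\<Sum>i\<in>I. (1/2::real) ^ n i) \<le> 1" .
  have "p i * n i \<le> 2 * p i - p i * log 2 (p i)" if i: "i \<in> I" for i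
  proof (cases "p i = 0")
    case False
    have "real (nat \<lceil>- log 2 (p i)\<rceil>) \<le> - log 2 (p i) + 1" using pos[OF i False] by linarith
    then have "p i * n i \<le> p i * (2 - log 2 (p i))"
      using pos[OF i False] by (intro mult_left_mono) (auto simp: n_def False)
    then show ?thesis by (simp add: algebra_simps)
  qed simp
  then have "(\<Sum>i\<in>I. p i * n i) \<le> (\<Sum>i\<in>I. 2 * p i - p i * log 2 (p i))" by (rule sum_mono)
  also have "\<dots> = 2 - (\<Sum>i\<in>I. p i * log 2 (p i))"
    using p by (simp add: sum_subtractf sum_distrib_left[symmetric])
  finally show thesis using that k by blast
qed

section \<open>Index words and McMillan's inequality\<close>

lemma finite_index_words [simp]: "finite (index_words N q)"
proof -
  have "index_words N q = {ns. set ns \<subseteq> {1..N} \<and> length ns = q}" by (auto simp: index_words_def)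
  then show ?thesis using finite_lists_length_eq[of "{1..N}" q] by simp
qed

lemma index_words_0 [simp]: "index_words N 0 = {[]}"
  by (auto simp: index_words_def)

lemma sum_index_words_append:
  "(\<Sum>ns\<in>index_words N (a + b). f ns) =
   (\<Sum>us\<in>index_words N a. \<Sum>vs\<in>index_words N b. f (us @ vs))"
proof -
  have "(\<Sum>us\<in>index_words N a. \<Sum>vs\<in>index_words N b. f (us @ vs)) =
      (\<Sum>(us, vs)\<in>index_words N a \<times> index_words N b. f (us @ vs))"
    by (rule sum.cartesian_product)
  also have "\<dots> = (\<Sum>ns\<in>index_words N (a + b). f ns)"
    by (rule sum.reindex_bij_witness[of _ "\<lambda>ns. (take a ns, drop a ns)" "\<lambda>(us, vs). us @ vs"])
       (auto simp: index_words_def dest: in_set_takeD in_set_dropD)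
  finally show ?thesis by simp
qed

lemma sum_index_words_1: "(\<Sum>ns\<in>index_words N (Suc 0). f ns) = (\<Sum>i = 1..N. f [i])"
  by (rule sum.reindex_bij_witness[of _ "\<lambda>i. [i]" hd])
     (auto simp: index_words_def length_Suc_conv)

lemma sum_index_words_Suc:
  "(\<Sum>ns\<in>index_words N (Suc m). f ns) = (\<Sum>i = 1..N. \<Sum>vs\<in>index_words N m. f (i # vs))"
  using sum_index_words_append[of f N "Suc 0" m] by (simp add: sum_index_words_1)

text \<open>Generating function of the word lengths: multiplying out the power gives one term per
  word.\<close>

lemma sum_power_index_words:
  fixes x :: real
  shows "(\<Sum>v\<in>index_words D m. x ^ sum_list (map n v)) = (\<Sum>i = 1..D. x ^ n i) ^ m"
  by (induction m)
     (simp_all add: sum_index_words_Suc power_add sum_distrib_left[symmetric] sum_distrib_right[symmetric])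

text \<open>
  McMillan's argument: a power of the Kraft sum grows at most linearly in the exponent.
\<close>

lemma kraft_of_word_count:
  fixes n :: "nat \<Rightarrow> nat"
  assumes count: "\<And>m t. m \<ge> 1 \<Longrightarrow> card {v\<in>index_words D m. sum_list (map n v) = t} \<le> 2 ^ t"
  shows "(\<Sum>i = 1..D. (1/2::real) ^ n i) \<le> 1"
proof (rule ccontr)
  define K where "K = (\<Sum>i = 1..D. (1/2::real) ^ n i)"
  assume "\<not> (\<Sum>i = 1..D. (1/2::real) ^ n i) \<le> 1"
  then have K: "K > 1" by (simp add: K_def)
  define B where "B = Max (insert 0 (n ` {1..D}))"
  have B: "n i \<le> B" if "i \<in> {1..D}" for i using that by (auto simp: B_def)
  have le: "K ^ m \<le> real (m * B + 1)" if m: "m \<ge> 1" for m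
  proof -
    have tot: "sum_list (map n v) \<le> m * B" if "v \<in> index_words D m" for v
    proof -
      have "sum_list (map n v) \<le> sum_list (map (\<lambda>_. B) v)"
        using that B by (intro sum_list_mono) (auto simp: index_words_def)
      then show ?thesis using that by (simp add: index_words_def sum_list_triv)
    qed
    have "K ^ m = (\<Sum>v\<in>index_words D m. (1/2) ^ sum_list (map n v))"
      by (simp add: K_def sum_power_index_words)
    \<comment> \<open>Grouped by total length \<open>t\<close>: at most \<open>2 ^ t\<close> words
      of weight \<open>(1/2) ^ t\<close>, so each of the \<open>m * B + 1\<close> groups contributes
      at most 1.\<close>
    also have "\<dots> = (\<Sum>t\<le>m * B. \<Sum>v\<in>{v\<in>index_words D m. sum_list (map n v) = t}. (1/2) ^ sum_list (map n v))"
      using tot by (intro sum.group[symmetric]) auto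
    also have "\<dots> = (\<Sum>t\<le>m * B. real (card {v\<in>index_words D m. sum_list (map n v) = t}) * (1/2) ^ t)"
      by (intro sum.cong) auto
    also have "\<dots> \<le> (\<Sum>t\<le>m * B. 1)"
    proof (rule sum_mono)
      fix t
      have "real (card {v\<in>index_words D m. sum_list (map n v) = t}) \<le> real (2 ^ t)"
        using count[OF m, of t] of_nat_le_iff by blast
      then have "real (card {v\<in>index_words D m. sum_list (map n v) = t}) * (1/2) ^ t \<le> 2 ^ t * (1/2) ^ t"
        by (intro mult_right_mono) auto
      then show "real (card {v\<in>index_words D m. sum_list (map n v) = t}) * (1/2) ^ t \<le> 1"
        by (simp add: power_one_over)
    qed
    finally show ?thesis by simp
  qed
  have "(\<lambda>m. real (m * B + 1) / K ^ m) \<longlonglongrightarrow> 0"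
  proof -
    have "(\<lambda>m. real B * (real m * (1/K) ^ m) + (1/K) ^ m) \<longlonglongrightarrow> real B * 0 + 0"
      using K by (intro tendsto_intros powser_times_n_limit_0 LIMSEQ_realpow_zero) auto
    then show ?thesis by (simp add: add_divide_distrib power_one_over mult_ac add_ac)
  qed
  then have "\<forall>\<^sub>F m in sequentially. real (m * B + 1) / K ^ m < 1"
    by (rule order_tendstoD) simp
  then obtain m0 where "\<forall>m\<ge>m0. real (m * B + 1) / K ^ m < 1" by (auto simp: eventually_sequentially)
  then have "real (Suc m0 * B + 1) / K ^ Suc m0 < 1" by (meson le_SucI order_refl)
  then have "real (Suc m0 * B + 1) < K ^ Suc m0" using K by (simp add: divide_less_eq del: power_Suc)
  then show False using le[of "Suc m0"] by linarith
qed

section \<open>Fekete's lemma\<close>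

text \<open>The limit is the infimum of the quotients. Only positive arguments occur, since the cost
  formulas are proved for positive block lengths.\<close>

lemma fekete_subadditive_convergent:
  fixes a :: "nat \<Rightarrow> real"
  assumes nn: "\<And>n. n \<ge> 1 \<Longrightarrow> 0 \<le> a n"
    and sub: "\<And>m n. m \<ge> 1 \<Longrightarrow> n \<ge> 1 \<Longrightarrow> a (m + n) \<le> a m + a n"
  obtains h where "(\<lambda>n. a n / n) \<longlonglongrightarrow> h"
proof -
  define S where "S = (\<lambda>n. a n / n) ` {1..}"
  have bdd: "bdd_below S" using nn by (auto simp: S_def intro!: bdd_belowI[of _ 0])
  have ne: "S \<noteq> {}" by (auto simp: S_def)
  define h where "h = Inf S"
  have low: "h \<le> a n / n" if "n \<ge> 1" for n
    unfolding h_def using that bdd by (intro cInf_lower) (auto simp: S_def)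
  have mult: "a (q * k + r) \<le> q * a k + a r" if "k \<ge> 1" "r \<ge> 1" for q k r
  proof (induction q)
    case (Suc q)
    have "a (Suc q * k + r) \<le> a k + a (q * k + r)"
      using sub[of k "q * k + r"] that by (simp add: add.assoc)
    then show ?case using Suc by (simp add: algebra_simps)
  qed simp
  have "(\<lambda>n. a n / n) \<longlonglongrightarrow> h"
  proof (rule order_tendstoI)
    fix y assume "y < h"
    then have "\<forall>n\<ge>1. y < a n / n" using low by (meson less_le_trans)
    then show "\<forall>\<^sub>F n in sequentially. y < a n / n" unfolding eventually_sequentially by blast
  next
    fix y assume "h < y"
    then obtain k where k: "k \<ge> 1" "a k / k < y"
      using ne bdd by (auto simp: h_def cInf_less_iff S_def)
    define C where "C = Max (a ` {1..k})"
    have C: "a r \<le> C" if "1 \<le> r" "r \<le> k" for r unfolding C_def using that by (intro Max_ge) auto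
    have C0: "0 \<le> C" using C[of k] nn[of k] k by simp
    have bound: "a n / n \<le> a k / k + C / n" if n: "n \<ge> 1" for n
    proof -
      \<comment> \<open>The remainder is shifted into \<open>1..k\<close>, as the hypotheses say
        nothing about \<open>a 0\<close>.\<close>
      define q where "q = (n - 1) div k"
      define r where "r = Suc ((n - 1) mod k)"
      have nqr: "n = q * k + r" using n by (simp add: q_def r_def)
      have r: "1 \<le> r" "r \<le> k" using k(1) by (auto simp: r_def Suc_le_eq)
      have "a n \<le> q * a k + a r" unfolding nqr using mult k r by blast
      also have "\<dots> \<le> (q * k) * (a k / k) + C" using k C[OF r] by simp
      also have "\<dots> \<le> n * (a k / k) + C"
        using nqr nn[OF k(1)] by (intro add_right_mono mult_right_mono) auto
      finally have "a n / n \<le> (n * (a k / k) + C) / n" by (intro divide_right_mono) auto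
      then show ?thesis using n by (simp add: add_divide_distrib)
    qed
    have "(\<lambda>n. a k / k + C / n) \<longlonglongrightarrow> a k / k + 0"
      by (intro tendsto_intros tendsto_divide_0[OF tendsto_const] filterlim_real_sequentially
          filterlim_at_top_imp_at_infinity)
    then have "\<forall>\<^sub>F n in sequentially. a k / k + C / n < y" using k by (intro order_tendstoD(2)) auto
    moreover have "\<forall>\<^sub>F n in sequentially. n \<ge> (1::nat)" by (rule eventually_ge_at_top)
    ultimately show "\<forall>\<^sub>F n in sequentially. a n / n < y"
      by eventually_elim (use bound in \<open>meson le_less_trans\<close>)
  qed
  then show thesis by (rule that)
qed

subsection \<open>Finitely supported vectors of the Fock space\<close>

text \<open>A divergent infinite sum has the value 0, so \<open>braket\<close> is not additive in
  general. The vectors of the proof have finite support, where it is a finite sum.\<close>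

definition finite_support :: "'a fock \<Rightarrow> bool" where
  "finite_support f \<longleftrightarrow> finite {w. f w \<noteq> 0}"

lemma finite_words_length [simp]: "finite {w :: 'a::finite list. length w = l}"
  using finite_lists_length_eq[of "UNIV :: 'a set" l] by simp

lemma card_words_length: "card {w :: 'a::finite list. length w = l} = CARD('a) ^ l"
  using card_lists_length_eq[of "UNIV :: 'a set" l] by simp

lemma tensor_power_finite_support [intro]:
  fixes f :: "'a::finite fock"
  assumes "f \<in> tensor_power l"
  shows "finite_support f"
  unfolding finite_support_def
  by (rule finite_subset[OF _ finite_words_length[of l]]) (use assms in \<open>auto simp: tensor_power_def\<close>)

lemma finite_support_sum [intro]:
  assumes "\<And>i. i \<in> I \<Longrightarrow> finite_support (g i)"
  shows "finite_support (\<lambda>w. \<Sum>i\<in>I. c i * g i w)"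
proof (cases "finite I")
  case True
  have "{w. (\<Sum>i\<in>I. c i * g i w) \<noteq> 0} \<subseteq> (\<Union>i\<in>I. {w. g i w \<noteq> 0})"
  proof
    fix w assume "w \<in> {w. (\<Sum>i\<in>I. c i * g i w) \<noteq> 0}"
    then have "\<not> (\<forall>i\<in>I. c i * g i w = 0)" using sum.neutral[of I "\<lambda>i. c i * g i w"] by blast
    then show "w \<in> (\<Union>i\<in>I. {w. g i w \<noteq> 0})" by auto
  qed
  moreover have "finite (\<Union>i\<in>I. {w. g i w \<noteq> 0})"
    using assms True by (simp add: finite_support_def)
  ultimately show ?thesis unfolding finite_support_def by (rule finite_subset)
qed (simp add: finite_support_def)

lemma tensor_power_sum:
  assumes "\<And>i. i \<in> I \<Longrightarrow> g i \<in> tensor_power l"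
  shows "(\<lambda>w. \<Sum>i\<in>I. c i * g i w) \<in> tensor_power l"
  using assms by (auto simp: tensor_power_def)

lemma tensor_power_add:
  "f \<in> tensor_power l \<Longrightarrow> g \<in> tensor_power l \<Longrightarrow> (\<lambda>w. a * f w + b * g w) \<in> tensor_power l"
  by (auto simp: tensor_power_def)

lemma ket_finite_support [simp]: "finite_support (ket w)"
  by (simp add: finite_support_def ket_def)

lemma ket_in_tensor_power: "ket w \<in> tensor_power l \<longleftrightarrow> length w = l"
  by (auto simp: ket_def tensor_power_def)

lemma finite_support_fock_space:
  assumes "finite_support f"
  shows "f \<in> fock_space"
proof -
  have "(\<lambda>w. (cmod (f w))\<^sup>2) summable_on {w. f w \<noteq> 0}"
    using assms by (simp add: finite_support_def)
  then have "(\<lambda>w. (cmod (f w))\<^sup>2) summable_on UNIV"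
    by (rule summable_on_cong_neutral[THEN iffD1, rotated -1]) auto
  then show ?thesis by (simp add: fock_space_def)
qed

lemma infsum_eq_finite_sum:
  fixes f :: "'b \<Rightarrow> 'c::{comm_monoid_add, t2_space}"
  assumes "finite W" "\<And>w. w \<notin> W \<Longrightarrow> f w = 0"
  shows "(\<Sum>\<^sub>\<infinity>w. f w) = (\<Sum>w\<in>W. f w)"
proof -
  have "(\<Sum>\<^sub>\<infinity>w. f w) = (\<Sum>\<^sub>\<infinity>w\<in>W. f w)"
    by (rule infsum_cong_neutral) (use assms in auto)
  then show ?thesis using assms by simp
qed

lemma braket_finite:
  assumes "finite W" "\<And>w. w \<notin> W \<Longrightarrow> f w = 0 \<or> g w = 0"
  shows "braket f g = (\<Sum>w\<in>W. cnj (f w) * g w)"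
  unfolding braket_def by (rule infsum_eq_finite_sum) (use assms in auto)

lemma braket_tensor_power:
  fixes f :: "'a::finite fock"
  assumes "f \<in> tensor_power l"
  shows "braket f g = (\<Sum>w | length w = l. cnj (f w) * g w)"
  by (rule braket_finite) (use assms in \<open>auto simp: tensor_power_def\<close>)

lemma braket_commute: "cnj (braket f g) = braket g f"
  unfolding braket_def infsum_cnj[symmetric] by (simp add: mult.commute)

lemma braket_sum_right:
  assumes "finite_support f"
  shows "braket f (\<lambda>w. \<Sum>i\<in>I. c i * g i w) = (\<Sum>i\<in>I. c i * braket f (g i))"
proof -
  define W where "W = {w. f w \<noteq> 0}"
  have *: "braket f h = (\<Sum>w\<in>W. cnj (f w) * h w)" for h
    by (rule braket_finite) (use assms in \<open>auto simp: finite_support_def W_def\<close>)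
  have "(\<Sum>w\<in>W. cnj (f w) * (\<Sum>i\<in>I. c i * g i w)) = (\<Sum>w\<in>W. \<Sum>i\<in>I. c i * (cnj (f w) * g i w))"
    by (simp add: sum_distrib_left mult_ac)
  also have "\<dots> = (\<Sum>i\<in>I. \<Sum>w\<in>W. c i * (cnj (f w) * g i w))" by (rule sum.swap)
  finally show ?thesis unfolding * by (simp add: sum_distrib_left)
qed

lemma braket_sum_left:
  assumes "finite_support g"
  shows "braket (\<lambda>w. \<Sum>i\<in>I. c i * f i w) g = (\<Sum>i\<in>I. cnj (c i) * braket (f i) g)"
proof -
  have "braket (\<lambda>w. \<Sum>i\<in>I. c i * f i w) g = cnj (\<Sum>i\<in>I. c i * braket g (f i))"
    using braket_sum_right[OF assms, where I = I and c = c and g = f] by (metis braket_commute)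
  then show ?thesis by (simp add: braket_commute)
qed

lemma braket_add_right:
  assumes "finite_support f"
  shows "braket f (\<lambda>w. a * g w + b * h w) = a * braket f g + b * braket f h"
  using braket_sum_right[OF assms, where I = "UNIV :: bool set" and c = "\<lambda>i. if i then a else b"
      and g = "\<lambda>i. if i then g else h"]
  by (simp add: UNIV_bool add.commute)

lemma braket_add_left:
  assumes "finite_support f"
  shows "braket (\<lambda>w. a * g w + b * h w) f = cnj a * braket g f + cnj b * braket h f"
  using braket_sum_left[OF assms, where I = "UNIV :: bool set" and c = "\<lambda>i. if i then a else b"
      and f = "\<lambda>i. if i then g else h"]
  by (simp add: UNIV_bool add.commute)

lemma braket_scale_right: "finite_support f \<Longrightarrow> braket f (\<lambda>w. a * g w) = a * braket f g"
  using braket_add_right[of f a g 0 g] by simp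

lemma braket_scale_left: "finite_support f \<Longrightarrow> braket (\<lambda>w. a * g w) f = cnj a * braket g f"
  using braket_add_left[of f a g 0 g] by simp

lemma braket_ket_left [simp]: "braket (ket w) f = f w"
  by (subst braket_finite[of "{w}"]) (auto simp: ket_def)

lemma braket_ket_right [simp]: "braket f (ket w) = cnj (f w)"
  by (metis braket_commute braket_ket_left)

text \<open>No summability is assumed: a divergent sum has the value 0 on both sides.\<close>

lemma braket_self: "braket f f = of_real (\<Sum>\<^sub>\<infinity>w. (cmod (f w))\<^sup>2)"
proof -
  have "cnj (f w) * f w = of_real ((cmod (f w))\<^sup>2)" for w
    by (simp only: complex_norm_square mult.commute)
  moreover have "(\<lambda>w. complex_of_real ((cmod (f w))\<^sup>2)) summable_on UNIV
      \<longleftrightarrow> (\<lambda>w. (cmod (f w))\<^sup>2) summable_on UNIV"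
    by (rule summable_on_bounded_linear_iff[OF bounded_linear_of_real bounded_linear_Re]) simp
  ultimately show ?thesis unfolding braket_def
    by (simp only: infsum_bounded_linear_strong[OF _ bounded_linear_of_real])
qed

lemma braket_self_nonneg: "0 \<le> Re (braket f f)" "Im (braket f f) = 0"
  by (simp_all add: braket_self infsum_nonneg)

lemma braket_self_eq_0:
  assumes "finite_support f" "Re (braket f f) = 0"
  shows "f w = 0"
proof (rule ccontr)
  assume "f w \<noteq> 0"
  define W where "W = {w. f w \<noteq> 0}"
  have W: "finite W" using assms by (simp add: finite_support_def W_def)
  have "braket f f = (\<Sum>w\<in>W. cnj (f w) * f w)" by (rule braket_finite[OF W]) (auto simp: W_def)
  then have "Re (braket f f) = (\<Sum>w\<in>W. (cmod (f w))\<^sup>2)"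
    by (simp add: cmod_power2) (simp add: power2_eq_square)
  moreover have "0 < (\<Sum>w\<in>W. (cmod (f w))\<^sup>2)"
    using W \<open>f w \<noteq> 0\<close> by (intro sum_pos2[of _ w]) (auto simp: W_def)
  ultimately show False using assms by simp
qed

section \<open>Orthonormal families and dimension counting\<close>

text \<open>The index type is free: the families are indexed by numbers, by words of codeword
  indices and by pairs.\<close>

definition orthonormal_family :: "'i set \<Rightarrow> ('i \<Rightarrow> 'a fock) \<Rightarrow> bool" where
  "orthonormal_family A f \<longleftrightarrow> finite A \<and> (\<forall>a\<in>A. finite_support (f a)) \<and>
     (\<forall>a\<in>A. \<forall>b\<in>A. braket (f a) (f b) = (if a = b then 1 else 0))"

lemma orthonormal_family_coefficient:
  assumes "orthonormal_family A f" "a \<in> A"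
  shows "braket (f a) (\<lambda>w. \<Sum>b\<in>A. c b * f b w) = c a"
proof -
  have "braket (f a) (\<lambda>w. \<Sum>b\<in>A. c b * f b w) = (\<Sum>b\<in>A. c b * braket (f a) (f b))"
    using assms by (intro braket_sum_right) (auto simp: orthonormal_family_def)
  also have "\<dots> = (\<Sum>b\<in>A. if a = b then c a else 0)"
    using assms by (intro sum.cong) (auto simp: orthonormal_family_def)
  finally show ?thesis using assms by (simp add: orthonormal_family_def)
qed

lemma orthonormal_family_norm:
  assumes "orthonormal_family A f"
  shows "braket (\<lambda>w. \<Sum>a\<in>A. c a * f a w) (\<lambda>w. \<Sum>a\<in>A. d a * f a w) = (\<Sum>a\<in>A. cnj (c a) * d a)"
proof -
  have "finite_support (\<lambda>w. \<Sum>a\<in>A. d a * f a w)"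
    using assms by (intro finite_support_sum) (auto simp: orthonormal_family_def)
  then show ?thesis
    by (simp add: braket_sum_left orthonormal_family_coefficient[OF assms])
qed

text \<open>The Gram-Schmidt remainder of \<open>g\<close>; the factors 1 and -1 give it the shape
  of \<open>braket_add_right\<close>.\<close>

definition residual :: "'i set \<Rightarrow> ('i \<Rightarrow> 'a fock) \<Rightarrow> 'a fock \<Rightarrow> 'a fock" where
  "residual A f g = (\<lambda>w. 1 * g w + (-1) * (\<Sum>a\<in>A. braket (f a) g * f a w))"

lemma residual_finite_support:
  assumes "orthonormal_family A f" "finite_support g"
  shows "finite_support (residual A f g)"
proof -
  have "finite_support (\<lambda>w. \<Sum>a\<in>A. braket (f a) g * f a w)"
    using assms by (intro finite_support_sum) (auto simp: orthonormal_family_def)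
  moreover have "{w. residual A f g w \<noteq> 0} \<subseteq> {w. g w \<noteq> 0} \<union> {w. (\<Sum>a\<in>A. braket (f a) g * f a w) \<noteq> 0}"
    by (auto simp: residual_def)
  ultimately show ?thesis using assms by (auto simp: finite_support_def intro: finite_subset)
qed

lemma residual_orthogonal:
  assumes "orthonormal_family A f" "a \<in> A"
  shows "braket (f a) (residual A f g) = 0"
  using assms orthonormal_family_coefficient[OF assms, of "\<lambda>a. braket (f a) g"]
  unfolding residual_def by (subst braket_add_right) (auto simp: orthonormal_family_def)

lemma residual_norm:
  assumes f: "orthonormal_family A f" and g: "finite_support g"
  shows "Re (braket (residual A f g) (residual A f g)) =
    Re (braket g g) - (\<Sum>a\<in>A. (cmod (braket (f a) g))\<^sup>2)"
proof -
  note r = residual_finite_support[OF f g]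
  have "braket (residual A f g) (residual A f g) =
      braket g (residual A f g) - braket (\<lambda>w. \<Sum>a\<in>A. braket (f a) g * f a w) (residual A f g)"
    using braket_add_left[OF r, of 1 g "-1" "\<lambda>w. \<Sum>a\<in>A. braket (f a) g * f a w"]
    by (simp add: residual_def)
  also have "braket (\<lambda>w. \<Sum>a\<in>A. braket (f a) g * f a w) (residual A f g) = 0"
    using residual_orthogonal[OF f] by (simp add: braket_sum_left[OF r])
  also have "braket g (residual A f g) = braket g g - (\<Sum>a\<in>A. braket (f a) g * braket g (f a))"
    unfolding residual_def braket_add_right[OF g] braket_sum_right[OF g] by simp
  also have "(\<Sum>a\<in>A. braket (f a) g * braket g (f a)) = of_real (\<Sum>a\<in>A. (cmod (braket (f a) g))\<^sup>2)"
    by (simp add: complex_norm_square braket_commute del: of_real_power)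
  finally show ?thesis by simp
qed

lemma bessel_inequality:
  assumes "orthonormal_family A f" "finite_support g"
  shows "(\<Sum>a\<in>A. (cmod (braket (f a) g))\<^sup>2) \<le> Re (braket g g)"
  using residual_norm[OF assms] braket_self_nonneg(1)[of "residual A f g"] by linarith

text \<open>The trace of the projection onto the span, taken in the basis of kets; exchanging the
  sums counts 1 for each unit vector.\<close>

lemma sum_norm_coordinates:
  fixes f :: "'i \<Rightarrow> 'a::finite fock"
  assumes "orthonormal_family A f" "\<forall>a\<in>A. f a \<in> tensor_power l"
  shows "(\<Sum>w | length w = l. \<Sum>a\<in>A. (cmod (f a w))\<^sup>2) = card A"
proof -
  have "(\<Sum>w | length w = l. (cmod (f a w))\<^sup>2) = 1" if "a \<in> A" for a
  proof -
    have "braket (f a) (f a) = 1" using assms that by (auto simp: orthonormal_family_def)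
    then have "of_real (\<Sum>w | length w = l. (cmod (f a w))\<^sup>2) = (1::complex)"
      using assms that
      by (simp add: braket_tensor_power[of _ l] complex_norm_square mult.commute del: of_real_power)
    then show ?thesis using of_real_eq_1_iff by blast
  qed
  then show ?thesis by (subst sum.swap) simp
qed

lemma sum_norm_coordinates_le:
  assumes "orthonormal_family A f"
  shows "(\<Sum>a\<in>A. (cmod (f a w))\<^sup>2) \<le> 1"
proof -
  have "(\<Sum>a\<in>A. (cmod (braket (f a) (ket w)))\<^sup>2) \<le> Re (braket (ket w) (ket w))"
    by (rule bessel_inequality[OF assms]) simp
  then show ?thesis unfolding braket_ket_right braket_ket_left by (simp add: ket_def)
qed

text \<open>A dimension bound by traces: each ket has a projection of norm at most 1. For qubits it
  allows at most \<open>2 ^ t\<close> codeword sequences of total length \<open>t\<close>.\<close>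

lemma orthonormal_family_card_le:
  fixes f :: "'i \<Rightarrow> 'a::finite fock"
  assumes "orthonormal_family A f" "\<forall>a\<in>A. f a \<in> tensor_power l"
  shows "card A \<le> CARD('a) ^ l"
proof -
  have "real (card A) \<le> (\<Sum>w :: 'a list | length w = l. 1)"
    unfolding sum_norm_coordinates[OF assms, symmetric]
    by (intro sum_mono sum_norm_coordinates_le assms)
  then have "real (card A) \<le> real (CARD('a) ^ l)" by (simp add: card_words_length del: of_nat_power)
  then show ?thesis by (simp del: of_nat_power)
qed

text \<open>
  Completeness by counting: the squared norms of the projections of the kets onto the span add up
  to \<open>card A\<close>, the number of kets, and each is at most 1.
\<close>

lemma orthonormal_family_complete:
  fixes f :: "'i \<Rightarrow> 'a::finite fock"
  assumes f: "orthonormal_family A f" "\<forall>a\<in>A. f a \<in> tensor_power l"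
    and card: "card A = CARD('a) ^ l" and g: "g \<in> tensor_power l"
  shows "g = (\<lambda>w. \<Sum>a\<in>A. braket (f a) g * f a w)"
proof -
  let ?W = "{w :: 'a list. length w = l}"
  have one: "(\<Sum>a\<in>A. (cmod (f a w))\<^sup>2) = 1" if w: "w \<in> ?W" for w
  proof -
    have "(\<Sum>w\<in>?W. 1 - (\<Sum>a\<in>A. (cmod (f a w))\<^sup>2)) = 0"
      unfolding sum_subtractf sum_norm_coordinates[OF f] by (simp add: card card_words_length)
    then have "\<forall>w\<in>?W. 1 - (\<Sum>a\<in>A. (cmod (f a w))\<^sup>2) = 0"
      using sum_norm_coordinates_le[OF f(1)] by (subst (asm) sum_nonneg_eq_0_iff) auto
    then show ?thesis using w by auto
  qed
  \<comment> \<open>A ket whose projection onto the span has full norm equals this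
    projection.\<close>
  have ket: "ket w v = (\<Sum>a\<in>A. cnj (f a w) * f a v)" if w: "w \<in> ?W" for w v
  proof -
    have "Re (braket (residual A f (ket w)) (residual A f (ket w))) = 0"
      using one[OF w] by (simp add: residual_norm[OF f(1)]) (simp add: ket_def)
    then have "residual A f (ket w) v = 0"
      by (rule braket_self_eq_0[OF residual_finite_support[OF f(1)], rotated]) simp
    then show ?thesis by (simp add: residual_def)
  qed
  show ?thesis
  proof
    fix v
    have "g v = (\<Sum>w\<in>?W. g w * ket w v)"
    proof (cases "v \<in> ?W")
      case True
      have "(\<Sum>w\<in>?W. g w * ket w v) = (\<Sum>w\<in>?W. if v = w then g v else 0)"
        by (intro sum.cong) (auto simp: ket_def)
      then show ?thesis using True by simp
    next
      case False
      then have "(\<Sum>w\<in>?W. g w * ket w v) = (\<Sum>w\<in>?W. 0)"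
        by (intro sum.cong) (auto simp: ket_def)
      then show ?thesis using False g by (simp add: tensor_power_def)
    qed
    also have "\<dots> = (\<Sum>w\<in>?W. \<Sum>a\<in>A. (cnj (f a w) * g w) * f a v)"
      by (intro sum.cong) (auto simp: ket sum_distrib_left mult_ac)
    also have "\<dots> = (\<Sum>a\<in>A. \<Sum>w\<in>?W. (cnj (f a w) * g w) * f a v)" by (rule sum.swap)
    also have "\<dots> = (\<Sum>a\<in>A. braket (f a) g * f a v)"
      using f by (intro sum.cong) (auto simp: braket_tensor_power[of _ l] sum_distrib_right)
    finally show "g v = (\<Sum>a\<in>A. braket (f a) g * f a v)" .
  qed
qed

lemma parseval:
  fixes f :: "'i \<Rightarrow> 'a::finite fock"
  assumes f: "orthonormal_family A f" "\<forall>a\<in>A. f a \<in> tensor_power l"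
    and card: "card A = CARD('a) ^ l" and g: "g \<in> tensor_power l"
  shows "(\<Sum>a\<in>A. (cmod (braket (f a) g))\<^sup>2) = Re (braket g g)"
proof -
  have "braket g g = (\<Sum>a\<in>A. cnj (braket (f a) g) * braket (f a) g)"
    using arg_cong2[where f = braket, OF orthonormal_family_complete[OF assms]
        orthonormal_family_complete[OF assms]]
    unfolding orthonormal_family_norm[OF f(1)] .
  also have "\<dots> = of_real (\<Sum>a\<in>A. (cmod (braket (f a) g))\<^sup>2)"
    by (simp add: complex_norm_square mult.commute del: of_real_power)
  finally show ?thesis by simp
qed

text \<open>Spanning comes from counting: there are as many orthonormal vectors as kets.\<close>

lemma orthonormal_basis_iff:
  fixes e :: "nat \<Rightarrow> 'a::finite fock"
  shows "orthonormal_basis l e \<longleftrightarrow>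
    orthonormal_family {1..CARD('a) ^ l} e \<and> (\<forall>i\<in>{1..CARD('a) ^ l}. e i \<in> tensor_power l)"
proof
  assume e: "orthonormal_family {1..CARD('a) ^ l} e \<and> (\<forall>i\<in>{1..CARD('a) ^ l}. e i \<in> tensor_power l)"
  have "\<exists>c. f = (\<lambda>w. \<Sum>i = 1..CARD('a) ^ l. c i * e i w)" if "f \<in> tensor_power l" for f
    using orthonormal_family_complete[of "{1..CARD('a) ^ l}" e l f] e that by auto
  then show "orthonormal_basis l e"
    using e by (auto simp: orthonormal_basis_def orthonormal_family_def)
qed (auto simp: orthonormal_basis_def orthonormal_family_def)

subsection \<open>The spectral theorem for mixtures of rank-one operators\<close>

text \<open>The ensemble state takes this form twice: over the source words, with kets that are in
  general not orthogonal, and over an eigenbasis, with the eigenvalues as weights.\<close>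

definition ketbra_mixture :: "'i set \<Rightarrow> ('i \<Rightarrow> real) \<Rightarrow> ('i \<Rightarrow> 'a fock) \<Rightarrow> 'a fock \<Rightarrow> 'a fock" where
  "ketbra_mixture T r s = (\<lambda>f w. \<Sum>t\<in>T. of_real (r t) * ketbra (s t) (s t) f w)"

lemma ketbra_mixture_altdef:
  "ketbra_mixture T r s f = (\<lambda>w. \<Sum>t\<in>T. (of_real (r t) * braket (s t) f) * s t w)"
  by (simp add: ketbra_mixture_def ketbra_def mult_ac)

context
  fixes T :: "'i set" and r :: "'i \<Rightarrow> real" and s :: "'i \<Rightarrow> 'a::finite fock" and l :: nat
  assumes s: "\<And>t. t \<in> T \<Longrightarrow> s t \<in> tensor_power l"
begin

private abbreviation "A \<equiv> ketbra_mixture T r s"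

lemma ketbra_mixture_in_tensor_power: "A f \<in> tensor_power l"
  unfolding ketbra_mixture_altdef by (rule tensor_power_sum) (rule s)

lemma braket_ketbra_mixture:
  assumes "finite_support f"
  shows "braket f (A g) = (\<Sum>t\<in>T. of_real (r t) * (braket f (s t) * braket (s t) g))"
  unfolding ketbra_mixture_altdef braket_sum_right[OF assms] by (simp add: mult_ac)

lemma ketbra_mixture_quadratic_form:
  assumes "finite_support f"
  shows "braket f (A f) = of_real (\<Sum>t\<in>T. r t * (cmod (braket (s t) f))\<^sup>2)"
proof -
  have "braket f (s t) * braket (s t) f = of_real ((cmod (braket (s t) f))\<^sup>2)" for t
    unfolding complex_norm_square braket_commute by (rule mult.commute)
  then show ?thesis unfolding braket_ketbra_mixture[OF assms] by simp
qed

lemma ketbra_mixture_hermitian: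
  assumes "finite_support f" "finite_support g"
  shows "braket (A f) g = braket f (A g)"
proof -
  have "braket (A f) g = cnj (braket g (A f))" by (simp add: braket_commute)
  also have "\<dots> = braket f (A g)"
    unfolding braket_ketbra_mixture[OF assms(1)] braket_ketbra_mixture[OF assms(2)]
    by (simp add: braket_commute mult_ac)
  finally show ?thesis .
qed

lemma ketbra_mixture_sum:
  "A (\<lambda>w. \<Sum>i\<in>I. c i * g i w) = (\<lambda>w. \<Sum>i\<in>I. c i * A (g i) w)"
proof
  fix w
  have "A (\<lambda>w. \<Sum>i\<in>I. c i * g i w) w =
      (\<Sum>t\<in>T. \<Sum>i\<in>I. c i * (of_real (r t) * braket (s t) (g i) * s t w))"
    unfolding ketbra_mixture_altdef
  proof (rule sum.cong[OF refl])
    fix t assume "t \<in> T"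
    then have "finite_support (s t)" using s by blast
    then show "of_real (r t) * braket (s t) (\<lambda>w. \<Sum>i\<in>I. c i * g i w) * s t w =
        (\<Sum>i\<in>I. c i * (of_real (r t) * braket (s t) (g i) * s t w))"
      by (simp add: braket_sum_right sum_distrib_left sum_distrib_right mult_ac)
  qed
  also have "\<dots> = (\<Sum>i\<in>I. \<Sum>t\<in>T. c i * (of_real (r t) * braket (s t) (g i) * s t w))"
    by (rule sum.swap)
  also have "\<dots> = (\<Sum>i\<in>I. c i * A (g i) w)"
    by (simp add: ketbra_mixture_altdef sum_distrib_left)
  finally show "A (\<lambda>w. \<Sum>i\<in>I. c i * g i w) w = (\<Sum>i\<in>I. c i * A (g i) w)" .
qed

lemma ketbra_mixture_add:
  "A (\<lambda>w. a * g w + b * h w) = (\<lambda>w. a * A g w + b * A h w)"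
  using ketbra_mixture_sum[where I = "UNIV :: bool set" and c = "\<lambda>i. if i then a else b"
      and g = "\<lambda>i. if i then g else h"]
  by (simp add: UNIV_bool add.commute)

text \<open>Vectors are functions, so compactness refers to the product topology: the set is closed
  in a product of unit discs over the words of length \<open>l\<close> and of {0} over all other
  words.\<close>

lemma unit_sphere_compact:
  fixes E :: "'a fock set"
  assumes E: "finite E" "E \<subseteq> tensor_power l"
  shows "compact {f \<in> tensor_power l. braket f f = 1 \<and> (\<forall>g\<in>E. braket g f = 0)}" (is "compact ?K")
proof -
  let ?W = "{w :: 'a list. length w = l}"
  define P :: "'a fock set" where "P = (\<Pi>\<^sub>E w\<in>UNIV. if length w = l then cball 0 1 else {0})"
  have "compactin (product_topology (\<lambda>_. euclidean) UNIV) P"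
    unfolding P_def compactin_PiE by (auto simp: compactin_euclidean_iff)
  then have "compact P" by (simp add: euclidean_product_topology compactin_euclidean_iff)
  \<comment> \<open>On the whole function space \<open>braket\<close> is an infinite sum; the finite
    sum \<open>F\<close> is continuous in the coordinates and agrees with it on the tensor
    power.\<close>
  define F where "F g f = (\<Sum>w\<in>?W. cnj (g w) * f w)" for g f :: "'a fock"
  have coord: "continuous_on UNIV (\<lambda>f :: 'a fock. f w)" for w
    by (rule continuous_on_product_coordinates)
  have "closed {f. F f f = 1}" "closed {f. F g f = 0}" for g
    unfolding F_def by (intro closed_Collect_eq continuous_intros coord)+
  then have "closed ({f. F f f = 1} \<inter> (\<Inter>g\<in>E. {f. F g f = 0}))"
    by (intro closed_Int closed_INT) auto
  then have "compact (P \<inter> ({f. F f f = 1} \<inter> (\<Inter>g\<in>E. {f. F g f = 0})))"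
    using \<open>compact P\<close> by (rule compact_Int_closed[rotated])
  also have "P \<inter> ({f. F f f = 1} \<inter> (\<Inter>g\<in>E. {f. F g f = 0})) = ?K"
  proof -
    have P: "f \<in> P \<longleftrightarrow> f \<in> tensor_power l \<and> (\<forall>w\<in>?W. cmod (f w) \<le> 1)" for f
      by (auto simp: P_def tensor_power_def PiE_iff split: if_splits)
    have br: "braket g f = F g f" if "g \<in> tensor_power l" for g f
      using that by (simp add: braket_tensor_power F_def)
    have unit: "cmod (f w) \<le> 1" if "F f f = 1" "w \<in> ?W" for f w
    proof -
      have "F f f = of_real (\<Sum>w\<in>?W. (cmod (f w))\<^sup>2)"
        unfolding F_def of_real_sum complex_norm_square by (simp add: mult.commute)
      then have "(\<Sum>w\<in>?W. (cmod (f w))\<^sup>2) = 1" using that(1) of_real_eq_1_iff by metis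
      moreover have "(cmod (f w))\<^sup>2 \<le> (\<Sum>w\<in>?W. (cmod (f w))\<^sup>2)"
        using that(2) by (intro member_le_sum) auto
      ultimately show ?thesis using abs_square_le_1[of "cmod (f w)"] by simp
    qed
    show ?thesis using E(2) by (auto simp: P br unit subset_iff)
  qed
  finally show ?thesis .
qed

text \<open>
  A maximiser \<open>f\<close> of the quadratic form on the unit sphere of the complement of the eigenvectors
  found so far is an eigenvector: otherwise a small step along \<open>A f - \<mu> f\<close> would increase the form.
\<close>

lemma ketbra_mixture_next_eigenvector:
  assumes e: "orthonormal_family I e" "\<forall>i\<in>I. e i \<in> tensor_power l"
    and eig: "\<forall>i\<in>I. A (e i) = (\<lambda>w. of_real (lam i) * e i w)"
    and card: "card I < CARD('a) ^ l"
  obtains f \<mu> where "f \<in> tensor_power l" "braket f f = 1" "\<forall>i\<in>I. braket (e i) f = 0"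
    "A f = (\<lambda>w. of_real \<mu> * f w)"
proof -
  let ?W = "{w :: 'a list. length w = l}"
  define V where "V = {f \<in> tensor_power l. \<forall>i\<in>I. braket (e i) f = 0}"
  have fsV: "finite_support f" if "f \<in> V" for f using that by (auto simp: V_def)
  have fse: "finite_support (e i)" if "i \<in> I" for i using that e by blast
  have Vadd: "(\<lambda>w. a * g w + b * h w) \<in> V" if "g \<in> V" "h \<in> V" for a b g h
    using that by (auto simp: V_def tensor_power_add braket_add_right fse)
  have Vscale: "(\<lambda>w. a * g w) \<in> V" if "g \<in> V" for a g
    using Vadd[OF that that, of a 0] by simp
  \<comment> \<open>Hermiticity makes the complement of the eigenvectors invariant, so the step
    direction \<open>h\<close> below stays inside it.\<close>
  have AV: "A g \<in> V" if g: "g \<in> V" for g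
  proof -
    have "braket (e i) (A g) = 0" if i: "i \<in> I" for i
    proof -
      have "braket (e i) (A g) = braket (A (e i)) g"
        using ketbra_mixture_hermitian[OF fse[OF i] fsV[OF g]] by simp
      also have "\<dots> = 0" using eig i g by (simp add: braket_scale_left[OF fsV[OF g]] V_def)
      finally show ?thesis .
    qed
    then show ?thesis by (simp add: V_def ketbra_mixture_in_tensor_power)
  qed
  define K where "K = {f \<in> tensor_power l. braket f f = 1 \<and> (\<forall>g\<in>e ` I. braket g f = 0)}"
  have "compact K" unfolding K_def
    using e by (intro unit_sphere_compact) (auto simp: orthonormal_family_def)
  have KV: "f \<in> K \<longleftrightarrow> f \<in> V \<and> braket f f = 1" for f by (auto simp: K_def V_def)
  define nrm where "nrm f = Re (braket f f)" for f :: "'a fock"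
  have nrm: "braket f f = of_real (nrm f)" for f by (simp add: nrm_def braket_self_nonneg complex_eq_iff)
  have normalise: "(\<lambda>w. of_real (1 / sqrt (nrm g)) * g w) \<in> K" if "g \<in> V" "nrm g \<noteq> 0" for g
  proof -
    have "nrm g > 0" using that braket_self_nonneg(1)[of g] by (simp add: nrm_def)
    then have "(1 / sqrt (nrm g)) * (1 / sqrt (nrm g)) * nrm g = 1" by simp
    then have "complex_of_real ((1 / sqrt (nrm g)) * (1 / sqrt (nrm g)) * nrm g) = 1" by (simp only: of_real_1)
    then have "cnj (of_real (1 / sqrt (nrm g))) * (of_real (1 / sqrt (nrm g)) * braket g g) = 1"
      unfolding nrm by (simp only: complex_cnj_complex_of_real of_real_mult mult_ac)
    moreover have fs: "finite_support (\<lambda>w. of_real (1 / sqrt (nrm g)) * g w)"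
      using fsV[OF Vscale[OF that(1)]] .
    ultimately show ?thesis unfolding KV
      using Vscale[OF that(1)] by (simp only: braket_scale_left[OF fs] braket_scale_right[OF fsV[OF that(1)]] simp_thms)
  qed
  \<comment> \<open>If every ket lay in the span, the trace \<open>card I\<close> would reach the
    number of kets. A ket outside the span leaves a nonzero remainder to normalise.\<close>
  have "K \<noteq> {}"
  proof -
    have "\<exists>w\<in>?W. (\<Sum>i\<in>I. (cmod (e i w))\<^sup>2) < 1"
    proof (rule ccontr)
      assume "\<not> ?thesis"
      then have "(\<Sum>w\<in>?W. 1) \<le> (\<Sum>w\<in>?W. \<Sum>i\<in>I. (cmod (e i w))\<^sup>2)" by (intro sum_mono) auto
      then show False unfolding sum_norm_coordinates[OF e] using card
        by (simp add: card_words_length del: of_nat_power)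
    qed
    then obtain w where w: "length w = l" "(\<Sum>i\<in>I. (cmod (e i w))\<^sup>2) < 1" by auto
    define g where "g = residual I e (ket w)"
    have "g \<in> tensor_power l" unfolding g_def residual_def
      using e w by (intro tensor_power_add tensor_power_sum) (auto simp: ket_in_tensor_power)
    then have "g \<in> V" using residual_orthogonal[OF e(1)] by (simp add: V_def g_def)
    have "nrm g = Re (braket (ket w) (ket w)) - (\<Sum>i\<in>I. (cmod (e i w))\<^sup>2)"
      unfolding nrm_def g_def residual_norm[OF e(1) ket_finite_support] by simp
    also have "braket (ket w) (ket w) = 1" unfolding braket_ket_left by (simp add: ket_def)
    finally have "nrm g \<noteq> 0" using w by simp
    then show ?thesis using normalise[OF \<open>g \<in> V\<close>] by blast
  qed
  define Q where "Q f = (\<Sum>t\<in>T. r t * (cmod (braket (s t) f))\<^sup>2)" for f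
  have Q: "braket f (A f) = of_real (Q f)" if "f \<in> V" for f
    unfolding Q_def by (rule ketbra_mixture_quadratic_form[OF fsV[OF that]])
  have "continuous_on K Q"
  proof -
    have br: "Q f = (\<Sum>t\<in>T. r t * (cmod (\<Sum>w\<in>?W. cnj (s t w) * f w))\<^sup>2)" for f
      unfolding Q_def by (intro sum.cong refl) (simp add: braket_tensor_power[OF s])
    have coord: "continuous_on UNIV (\<lambda>f :: 'a fock. f w)" for w
      by (rule continuous_on_product_coordinates)
    have "continuous_on UNIV (\<lambda>f. \<Sum>t\<in>T. r t * (cmod (\<Sum>w\<in>?W. cnj (s t w) * f w))\<^sup>2)"
      by (intro continuous_intros coord)
    then show ?thesis unfolding br[symmetric] by (rule continuous_on_subset) simp
  qed
  then obtain f where f: "f \<in> K" "\<forall>g\<in>K. Q g \<le> Q f"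
    using continuous_attains_sup[OF \<open>compact K\<close> \<open>K \<noteq> {}\<close>] by blast
  define \<mu> where "\<mu> = Q f"
  have fV: "f \<in> V" "braket f f = 1" using f KV by auto
  \<comment> \<open>By homogeneity, maximality on the unit sphere becomes a quadratic inequality on
    all of \<open>V\<close>.\<close>
  have le: "Q g \<le> \<mu> * nrm g" if g: "g \<in> V" for g
  proof (cases "nrm g = 0")
    case True
    then have "g w = 0" for w using braket_self_eq_0[OF fsV[OF g]] by (simp add: nrm_def)
    then have "Q g = 0" unfolding Q_def by (simp add: braket_def)
    then show ?thesis using True by simp
  next
    case False
    then have pos: "nrm g > 0" using braket_self_nonneg(1)[of g] by (simp add: nrm_def)
    have "Q (\<lambda>w. of_real c * g w) = c\<^sup>2 * Q g" for c
    proof -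
      have "cmod (braket (s t) (\<lambda>w. of_real c * g w)) = \<bar>c\<bar> * cmod (braket (s t) g)" if "t \<in> T" for t
        using tensor_power_finite_support[OF s[OF that]] by (simp add: braket_scale_right norm_mult)
      then show ?thesis by (simp add: Q_def sum_distrib_left power_mult_distrib mult_ac)
    qed
    then have "(1 / sqrt (nrm g))\<^sup>2 * Q g \<le> \<mu>" using f(2) normalise[OF g False] unfolding \<mu>_def by metis
    then show ?thesis using pos by (simp add: power_divide field_simps)
  qed
  define h where "h = (\<lambda>w. 1 * A f w + (- of_real \<mu>) * f w)"
  have hV: "h \<in> V" unfolding h_def by (intro Vadd AV fV)
  define a where "a = Re (braket h (A f))"
  define b where "b = Re (braket h f)"
  have nh: "nrm h = a - \<mu> * b"
  proof -
    have "braket h h = 1 * braket h (A f) + (- of_real \<mu>) * braket h f"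
      using braket_add_right[OF fsV[OF hV], of 1 "A f" "- of_real \<mu>" f] by (simp only: h_def[symmetric])
    then show ?thesis by (simp add: nrm_def a_def b_def)
  qed
  \<comment> \<open>This is \<open>le\<close> at f + t h: the terms of order 0 cancel, and the
    linear ones combine to \<open>2 * t * nrm h\<close> because
    \<open>nrm h = a - \<mu> * b\<close>.\<close>
  have step: "2 * t * nrm h \<le> t\<^sup>2 * (\<mu> * nrm h - Q h)" for t :: real
  proof -
    define x where "x = (\<lambda>w. 1 * f w + of_real t * h w)"
    have xV: "x \<in> V" unfolding x_def by (intro Vadd hV fV)
    note fs = fsV[OF fV(1)] fsV[OF hV] fsV[OF xV] fsV[OF AV[OF fV(1)]] fsV[OF AV[OF hV]]
    have xl: "braket x g = braket f g + of_real t * braket h g" if "finite_support g" for g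
      unfolding x_def braket_add_left[OF that] by simp
    have xr: "braket g x = braket g f + of_real t * braket g h" if "finite_support g" for g
      unfolding x_def braket_add_right[OF that] by simp
    have Ax: "braket g (A x) = braket g (A f) + of_real t * braket g (A h)" if "finite_support g" for g
      unfolding x_def ketbra_mixture_add braket_add_right[OF that] by simp
    have sym: "Re (braket f h) = b" unfolding b_def
      using arg_cong[OF braket_commute[of h f], of Re] by simp
    have symA: "Re (braket f (A h)) = a" unfolding a_def
      using ketbra_mixture_hermitian[OF fs(1) fs(2)] arg_cong[OF braket_commute[of h "A f"], of Re]
      by simp
    have "nrm x = 1 + 2 * t * b + t\<^sup>2 * nrm h"
      unfolding nrm_def xl[OF fs(3)] xr[OF fs(1)] xr[OF fs(2)]
      using fV(2) sym by (simp add: b_def power2_eq_square algebra_simps)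
    moreover have "Re (braket x (A x)) = \<mu> + 2 * t * a + t\<^sup>2 * Q h"
      unfolding Ax[OF fs(3)] xl[OF fs(4)] xl[OF fs(5)] Q[OF fV(1)] Q[OF hV]
      using symA by (simp add: a_def \<mu>_def power2_eq_square algebra_simps)
    then have "Q x = \<mu> + 2 * t * a + t\<^sup>2 * Q h" unfolding Q[OF xV] by simp
    ultimately have "\<mu> + 2 * t * a + t\<^sup>2 * Q h \<le> \<mu> * (1 + 2 * t * b + t\<^sup>2 * nrm h)"
      using le[OF xV] by simp
    moreover have "2 * t * nrm h = 2 * t * a - \<mu> * (2 * t * b)" by (simp add: nh algebra_simps)
    ultimately show ?thesis by (simp add: algebra_simps)
  qed
  have nh0: "nrm h \<ge> 0" unfolding nrm_def by (rule braket_self_nonneg)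
  have "nrm h = 0"
  proof (rule ccontr)
    assume "nrm h \<noteq> 0"
    then have p: "nrm h > 0" using nh0 by simp
    \<comment> \<open>The step length \<open>nrm h / C\<close> keeps the second-order side at
      \<open>nrm h\<close> at most, against \<open>2 * nrm h\<close> from the linear term. The added
      1 makes \<open>C\<close> positive.\<close>
    define C where "C = \<bar>\<mu> * nrm h - Q h\<bar> + 1"
    define t where "t = nrm h / C"
    have C: "C > 0" "\<mu> * nrm h - Q h \<le> C" by (auto simp: C_def)
    have t: "t > 0" using p C by (simp add: t_def)
    have "t * (2 * nrm h) \<le> t * (t * (\<mu> * nrm h - Q h))"
      using step[of t] by (simp add: power2_eq_square mult_ac)
    then have "2 * nrm h \<le> t * (\<mu> * nrm h - Q h)" using t by simp
    also have "\<dots> \<le> t * C" using t C by (intro mult_left_mono) auto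
    also have "\<dots> = nrm h" using C by (simp add: t_def)
    finally show False using p by simp
  qed
  then have "h w = 0" for w using braket_self_eq_0[OF fsV[OF hV]] by (simp add: nrm_def)
  then have "A f = (\<lambda>w. of_real \<mu> * f w)" by (auto simp: h_def fun_eq_iff)
  then show thesis using that fV by (auto simp: V_def)
qed

text \<open>\<open>op_log2\<close> chooses a decomposition with \<open>SOME\<close>, so one has to
  exist. Eigenvectors are added one at a time; once there are \<open>CARD('a) ^ l\<close> of them,
  counting gives completeness.\<close>

theorem ketbra_mixture_spectral_decomposition:
  "\<exists>lam e. spectral_decomposition l A lam e"
proof -
  have "\<exists>lam e. orthonormal_family {1..k} e \<and> (\<forall>i\<in>{1..k}. e i \<in> tensor_power l) \<and>
      (\<forall>i\<in>{1..k}. A (e i) = (\<lambda>w. of_real (lam i) * e i w))" if "k \<le> CARD('a) ^ l" for k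
    using that
  proof (induction k)
    case 0
    then show ?case by (auto simp: orthonormal_family_def)
  next
    case (Suc k)
    then obtain lam e where e: "orthonormal_family {1..k} e" "\<forall>i\<in>{1..k}. e i \<in> tensor_power l"
      "\<forall>i\<in>{1..k}. A (e i) = (\<lambda>w. of_real (lam i) * e i w)" by (meson Suc_leD)
    obtain f \<mu> where f: "f \<in> tensor_power l" "braket f f = 1" "\<forall>i\<in>{1..k}. braket (e i) f = 0"
      "A f = (\<lambda>w. of_real \<mu> * f w)"
      using ketbra_mixture_next_eigenvector[OF e] Suc.prems by auto
    have f': "\<forall>i\<in>{1..k}. braket f (e i) = 0" using f(3) by (metis braket_commute complex_cnj_zero)
    define e' where "e' = e(Suc k := f)"
    define lam' where "lam' = lam(Suc k := \<mu>)"
    have e'l: "e' i = e i" "lam' i = lam i" if "i \<in> {1..k}" for i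
      using that by (auto simp: e'_def lam'_def)
    have e'k: "e' (Suc k) = f" "lam' (Suc k) = \<mu>" by (auto simp: e'_def lam'_def)
    have split: "{1..Suc k} = insert (Suc k) {1..k}" by auto
    have "orthonormal_family {1..Suc k} e'"
      unfolding orthonormal_family_def split
      using e(1) f f' tensor_power_finite_support[OF f(1)]
      by (auto simp: e'k e'l orthonormal_family_def)
    moreover have "\<forall>i\<in>{1..Suc k}. e' i \<in> tensor_power l" unfolding split using e(2) f by (auto simp: e'k e'l)
    moreover have "\<forall>i\<in>{1..Suc k}. A (e' i) = (\<lambda>w. of_real (lam' i) * e' i w)"
      unfolding split using e(3) f by (auto simp: e'k e'l)
    ultimately show ?case by blast
  qed
  then obtain lam e where e: "orthonormal_family {1..CARD('a) ^ l} e"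
    "\<forall>i\<in>{1..CARD('a) ^ l}. e i \<in> tensor_power l"
    "\<forall>i\<in>{1..CARD('a) ^ l}. A (e i) = (\<lambda>w. of_real (lam i) * e i w)" by blast
  have "A f = (\<lambda>w. \<Sum>i = 1..CARD('a) ^ l. of_real (lam i) * ketbra (e i) (e i) f w)"
    if "f \<in> tensor_power l" for f
  proof -
    have "A f = A (\<lambda>w. \<Sum>i = 1..CARD('a) ^ l. braket (e i) f * e i w)"
      using orthonormal_family_complete[OF e(1,2) _ that] by simp
    also have "\<dots> = (\<lambda>w. \<Sum>i = 1..CARD('a) ^ l. braket (e i) f * A (e i) w)"
      by (rule ketbra_mixture_sum)
    also have "\<dots> = (\<lambda>w. \<Sum>i = 1..CARD('a) ^ l. of_real (lam i) * ketbra (e i) (e i) f w)"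
      using e(3) by (simp add: ketbra_def mult_ac)
    finally show ?thesis .
  qed
  then show ?thesis using e unfolding spectral_decomposition_def orthonormal_basis_iff by blast
qed

end

subsection \<open>Concatenation and jointly orthonormal codewords\<close>

text \<open>With fixed degrees only the cut after \<open>a\<close> letters survives, and
  concatenation is the tensor product.\<close>

lemma fock_concat_tensor_power:
  assumes "f \<in> tensor_power a" "g \<in> tensor_power b"
  shows "fock_concat f g w = (if length w = a + b then f (take a w) * g (drop a w) else 0)"
proof -
  have "fock_concat f g w = (\<Sum>k\<le>length w. if k = a \<and> length w = a + b then f (take a w) * g (drop a w) else 0)"
    unfolding fock_concat_def
  proof (rule sum.cong[OF refl])
    fix k assume k: "k \<in> {..length w}"
    show "f (take k w) * g (drop k w) =
        (if k = a \<and> length w = a + b then f (take a w) * g (drop a w) else 0)"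
    proof (cases "k = a \<and> length w = a + b")
      case False
      then have "length (take k w) \<noteq> a \<or> length (drop k w) \<noteq> b" using k by auto
      then have "f (take k w) = 0 \<or> g (drop k w) = 0" using assms unfolding tensor_power_def by blast
      then show ?thesis using False by auto
    qed simp
  qed
  then show ?thesis by (cases "length w = a + b") simp_all
qed

lemma fock_concat_in_tensor_power:
  "f \<in> tensor_power a \<Longrightarrow> g \<in> tensor_power b \<Longrightarrow> fock_concat f g \<in> tensor_power (a + b)"
  by (simp add: tensor_power_def[of "a + b"] fock_concat_tensor_power)

lemma fock_concat_ket: "fock_concat (ket u) (ket v) = ket (u @ v)"
proof
  fix w
  have "fock_concat (ket u) (ket v) w =
      (if length w = length u + length v then ket u (take (length u) w) * ket v (drop (length u) w) else 0)"
    by (rule fock_concat_tensor_power) (simp_all add: ket_in_tensor_power)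
  moreover have "take (length u) w \<noteq> u \<or> drop (length u) w \<noteq> v" if "w \<noteq> u @ v"
    using that by (metis append_take_drop_id)
  ultimately show "fock_concat (ket u) (ket v) w = ket (u @ v) w"
    by (cases "w = u @ v") (auto simp: ket_def)
qed

lemma fock_concat_list_ket:
  "fock_concat_list (map (\<lambda>i. ket (c i)) v) = ket (concat (map c v))"
  by (induction v) (simp_all add: fock_concat_list_def fock_concat_ket)

lemma fock_concat_list_in_tensor_power:
  assumes "\<And>i. i \<in> set v \<Longrightarrow> \<psi> i \<in> tensor_power (n i)"
  shows "fock_concat_list (map \<psi> v) \<in> tensor_power (sum_list (map n v))"
  using assms
proof (induction v)
  case Nil
  then show ?case by (simp add: fock_concat_list_def ket_in_tensor_power)
next
  case (Cons i v)
  then show ?case by (simp add: fock_concat_list_def fock_concat_in_tensor_power)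
qed

lemma fock_concat_sum:
  "fock_concat (\<lambda>w. \<Sum>i\<in>I. c i * f i w) (\<lambda>w. \<Sum>j\<in>J. d j * g j w) =
   (\<lambda>w. \<Sum>i\<in>I. \<Sum>j\<in>J. (c i * d j) * fock_concat (f i) (g j) w)"
proof
  fix w
  have "fock_concat (\<lambda>w. \<Sum>i\<in>I. c i * f i w) (\<lambda>w. \<Sum>j\<in>J. d j * g j w) w =
      (\<Sum>k\<le>length w. \<Sum>i\<in>I. \<Sum>j\<in>J. (c i * d j) * (f i (take k w) * g j (drop k w)))"
    unfolding fock_concat_def sum_product by (simp add: mult_ac)
  also have "\<dots> = (\<Sum>i\<in>I. \<Sum>k\<le>length w. \<Sum>j\<in>J. (c i * d j) * (f i (take k w) * g j (drop k w)))"
    by (rule sum.swap)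
  also have "\<dots> = (\<Sum>i\<in>I. \<Sum>j\<in>J. \<Sum>k\<le>length w. (c i * d j) * (f i (take k w) * g j (drop k w)))"
    by (intro sum.cong refl sum.swap)
  also have "\<dots> = (\<Sum>i\<in>I. \<Sum>j\<in>J. (c i * d j) * fock_concat (f i) (g j) w)"
    by (simp add: fock_concat_def sum_distrib_left)
  finally show "fock_concat (\<lambda>w. \<Sum>i\<in>I. c i * f i w) (\<lambda>w. \<Sum>j\<in>J. d j * g j w) w = \<dots>" .
qed

text \<open>Multilinearity. With \<open>c k i\<close> the amplitude of codeword
  \<open>\<psi> i\<close> in block \<open>k\<close>, it expands an encoded message in the jointly
  orthonormal sequences of codewords.\<close>

lemma fock_concat_list_expand:
  "fock_concat_list (map (\<lambda>k w. \<Sum>i = 1..D. c k i * \<psi> i w) ks) =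
   (\<lambda>w. \<Sum>v\<in>index_words D (length ks). prod_list (map2 c ks v) * fock_concat_list (map \<psi> v) w)"
proof (induction ks)
  case Nil
  then show ?case by (simp add: fock_concat_list_def)
next
  case (Cons k ks)
  have "fock_concat_list (map (\<lambda>k w. \<Sum>i = 1..D. c k i * \<psi> i w) (k # ks)) =
      fock_concat (\<lambda>w. \<Sum>i = 1..D. c k i * \<psi> i w)
        (fock_concat_list (map (\<lambda>k w. \<Sum>i = 1..D. c k i * \<psi> i w) ks))"
    by (simp add: fock_concat_list_def)
  also have "\<dots> = (\<lambda>w. \<Sum>i = 1..D. \<Sum>v\<in>index_words D (length ks).
      (c k i * prod_list (map2 c ks v)) * fock_concat (\<psi> i) (fock_concat_list (map \<psi> v)) w)"
    unfolding Cons.IH by (rule fock_concat_sum)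
  also have "\<dots> = (\<lambda>w. \<Sum>v\<in>index_words D (length (k # ks)).
      prod_list (map2 c (k # ks) v) * fock_concat_list (map \<psi> v) w)"
    by (simp add: sum_index_words_Suc fock_concat_list_def)
  finally show ?case .
qed

lemma sum_words_length_append:
  fixes F :: "'a::finite list \<Rightarrow> 'c::comm_monoid_add"
  shows "(\<Sum>w | length w = a + b. F w) = (\<Sum>u | length u = a. \<Sum>v | length v = b. F (u @ v))"
proof -
  have "(\<Sum>u | length u = a. \<Sum>v | length v = b. F (u @ v)) =
      (\<Sum>(u, v)\<in>{u. length u = a} \<times> {v. length v = b}. F (u @ v))"
    by (rule sum.cartesian_product)
  also have "\<dots> = (\<Sum>w | length w = a + b. F w)"
    by (rule sum.reindex_bij_witness[of _ "\<lambda>w. (take a w, drop a w)" "\<lambda>(u, v). u @ v"]) auto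
  finally show ?thesis by simp
qed

lemma braket_fock_concat:
  fixes f g f' g' :: "'a::finite fock"
  assumes "f \<in> tensor_power a" "f' \<in> tensor_power a" "g \<in> tensor_power b" "g' \<in> tensor_power b"
  shows "braket (fock_concat f g) (fock_concat f' g') = braket f f' * braket g g'"
proof -
  have "braket (fock_concat f g) (fock_concat f' g') =
      (\<Sum>w | length w = a + b. cnj (fock_concat f g w) * fock_concat f' g' w)"
    using assms by (intro braket_tensor_power fock_concat_in_tensor_power)
  also have "\<dots> = (\<Sum>u | length u = a. \<Sum>v | length v = b. (cnj (f u) * f' u) * (cnj (g v) * g' v))"
    unfolding sum_words_length_append using assms
    by (intro sum.cong) (auto simp: fock_concat_tensor_power)
  also have "\<dots> = braket f f' * braket g g'"
    using assms by (simp add: braket_tensor_power sum_product)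
  finally show ?thesis .
qed

lemma tensor_ket_in_tensor_power: "length vs = l \<Longrightarrow> tensor_ket vs \<in> tensor_power l"
  by (simp add: tensor_ket_def tensor_power_def)

lemma tensor_ket_append: "tensor_ket (us @ vs) = fock_concat (tensor_ket us) (tensor_ket vs)"
proof
  fix w
  have split: "(\<Prod>i<a + b. f i) = (\<Prod>i<a. f i) * (\<Prod>i<b. f (a + i))" for f :: "nat \<Rightarrow> complex" and a b
    by (induction b) (simp_all add: mult.assoc)
  have "fock_concat (tensor_ket us) (tensor_ket vs) w =
      (if length w = length us + length vs
       then tensor_ket us (take (length us) w) * tensor_ket vs (drop (length us) w) else 0)"
    by (rule fock_concat_tensor_power) (simp_all add: tensor_ket_in_tensor_power)
  then show "tensor_ket (us @ vs) w = fock_concat (tensor_ket us) (tensor_ket vs) w"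
    by (simp add: tensor_ket_def split nth_append)
qed

lemma tensor_ket_unit:
  fixes vs :: "(complex ^ 'a::finite) list"
  assumes "\<forall>x\<in>set vs. norm x = 1"
  shows "braket (tensor_ket vs) (tensor_ket vs) = 1"
  using assms
proof (induction vs)
  case Nil
  have "tensor_ket ([] :: (complex ^ 'a) list) = ket []"
    by (auto simp: tensor_ket_def ket_def)
  then have "braket (tensor_ket ([] :: (complex ^ 'a) list)) (tensor_ket []) = ket [] ([] :: 'a list)"
    by (simp only: braket_ket_left)
  then show ?case by (simp add: ket_def)
next
  case (Cons x vs)
  have "braket (tensor_ket [x]) (tensor_ket [x]) =
      (\<Sum>w | length w = Suc 0. cnj (tensor_ket [x] w) * tensor_ket [x] w)"
    by (rule braket_tensor_power) (simp add: tensor_ket_in_tensor_power)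
  also have "\<dots> = (\<Sum>i\<in>UNIV. cnj (x $ i) * (x $ i))"
    by (rule sum.reindex_bij_witness[of _ "\<lambda>i. [i]" hd])
       (auto simp: length_Suc_conv tensor_ket_def)
  also have "\<dots> = of_real (\<Sum>i\<in>UNIV. (cmod (x $ i))\<^sup>2)"
    unfolding of_real_sum complex_norm_square by (simp add: mult.commute)
  also have "(\<Sum>i\<in>UNIV. (cmod (x $ i))\<^sup>2) = (norm x)\<^sup>2"
    by (simp add: norm_vec_def L2_set_def sum_nonneg)
  finally have "braket (tensor_ket [x]) (tensor_ket [x]) = 1" using Cons.prems by simp
  then show ?case
    using braket_fock_concat[of "tensor_ket [x]" 1 "tensor_ket [x]" "tensor_ket vs" "length vs" "tensor_ket vs"]
      Cons tensor_ket_append[of "[x]" vs]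
    by (simp add: tensor_ket_in_tensor_power)
qed

section \<open>Kraft's inequality for quantum codewords\<close>

lemma jointly_orthonormal_family:
  assumes "jointly_orthonormal D \<psi>" "\<And>i. i \<in> {1..D} \<Longrightarrow> \<psi> i \<in> tensor_power (n i)" "m \<ge> 1"
  shows "orthonormal_family (index_words D m) (\<lambda>v. fock_concat_list (map \<psi> v))"
proof -
  have "finite_support (fock_concat_list (map \<psi> v))" if "v \<in> index_words D m" for v
  proof -
    have "fock_concat_list (map \<psi> v) \<in> tensor_power (sum_list (map n v))"
      using that assms(2) by (intro fock_concat_list_in_tensor_power) (auto simp: index_words_def)
    then show ?thesis by blast
  qed
  then show ?thesis using assms by (auto simp: orthonormal_family_def jointly_orthonormal_def)
qed

text \<open>Orthonormality of the single codewords would not suffice: the kets of the empty string,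
  0 and 1 are orthonormal and have Kraft sum 2. Joint orthonormality yields one vector per word for
  every word length \<open>m\<close>, which is the count that McMillan's argument asks for.\<close>

lemma jointly_orthonormal_kraft:
  assumes "jointly_orthonormal D \<psi>" "\<And>i. i \<in> {1..D} \<Longrightarrow> \<psi> i \<in> tensor_power (n i)"
  shows "(\<Sum>i = 1..D. (1/2::real) ^ n i) \<le> 1"
proof (rule kraft_of_word_count)
  fix m t :: nat assume m: "m \<ge> 1"
  let ?A = "{v \<in> index_words D m. sum_list (map n v) = t}"
  have "orthonormal_family ?A (\<lambda>v. fock_concat_list (map \<psi> v))"
    using jointly_orthonormal_family[OF assms m] by (auto simp: orthonormal_family_def)
  moreover have "\<forall>v\<in>?A. fock_concat_list (map \<psi> v) \<in> tensor_power t"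
  proof
    fix v assume "v \<in> ?A"
    then have "set v \<subseteq> {1..D}" "sum_list (map n v) = t" by (simp_all add: index_words_def)
    then show "fock_concat_list (map \<psi> v) \<in> tensor_power t"
      using fock_concat_list_in_tensor_power[of v \<psi> n] assms(2) by blast
  qed
  ultimately show "card ?A \<le> 2 ^ t" using orthonormal_family_card_le by fastforce
qed

section \<open>Expected length of a superposition of codewords\<close>

lemma length_observable_altdef: "length_observable f = (\<lambda>w. of_nat (length w) * f w)"
proof
  fix w
  have "length_observable f w = (\<Sum>n\<in>{length w}. of_nat n * length_proj n f w)"
    unfolding length_observable_def by (rule infsum_eq_finite_sum) (auto simp: length_proj_def)
  then show "length_observable f w = of_nat (length w) * f w" by (simp add: length_proj_def)
qed

lemma op_trace_length_observable:
  assumes "finite_support x"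
  shows "op_trace (ketbra x x \<circ> length_observable) = braket x (\<lambda>w. of_nat (length w) * x w)"
proof -
  have "braket (ket w) ((ketbra x x \<circ> length_observable) (ket w)) = cnj (x w) * (of_nat (length w) * x w)" for w
  proof -
    have "length_observable (ket w) = (\<lambda>v. of_nat (length w) * ket w v)"
      by (auto simp: length_observable_altdef ket_def)
    then have "braket x (length_observable (ket w)) = of_nat (length w) * cnj (x w)"
      using braket_scale_right[OF assms] by simp
    then show ?thesis by (simp add: ketbra_def mult_ac)
  qed
  then show ?thesis by (simp add: op_trace_def braket_def)
qed

text \<open>Every \<open>f a\<close> is an eigenvector of the length observable with eigenvalue
  \<open>n a\<close>, so different codewords do not interfere and the expected length is that of a
  classical mixture.\<close>

lemma op_trace_length_observable_superposition:
  assumes f: "orthonormal_family A f" "\<forall>a\<in>A. f a \<in> tensor_power (n a)"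
    and x: "x = (\<lambda>w. \<Sum>a\<in>A. c a * f a w)"
  shows "op_trace (ketbra x x \<circ> length_observable) = of_real (\<Sum>a\<in>A. (cmod (c a))\<^sup>2 * n a)"
proof -
  have "finite_support x" unfolding x using f(1) by (intro finite_support_sum) (auto simp: orthonormal_family_def)
  moreover have "of_nat (length w) * x w = (\<Sum>a\<in>A. (c a * of_nat (n a)) * f a w)" for w
    unfolding x sum_distrib_left
  proof (rule sum.cong[OF refl])
    fix a assume "a \<in> A"
    then have "f a w = 0 \<or> length w = n a" using f(2) by (auto simp: tensor_power_def)
    then show "of_nat (length w) * (c a * f a w) = c a * of_nat (n a) * f a w" by auto
  qed
  ultimately have "op_trace (ketbra x x \<circ> length_observable) =
      braket (\<lambda>w. \<Sum>a\<in>A. c a * f a w) (\<lambda>w. \<Sum>a\<in>A. (c a * of_nat (n a)) * f a w)"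
    by (simp add: op_trace_length_observable) (simp add: x)
  also have "\<dots> = (\<Sum>a\<in>A. cnj (c a) * (c a * of_nat (n a)))" by (rule orthonormal_family_norm[OF f(1)])
  also have "\<dots> = of_real (\<Sum>a\<in>A. (cmod (c a))\<^sup>2 * n a)"
    unfolding of_real_sum of_real_mult complex_norm_square by (simp add: mult_ac)
  finally show ?thesis .
qed

text \<open>Linearity of expectation for independent indices. The normalisation is part of the claim
  because the induction step uses it.\<close>

lemma product_distribution_expected_sum:
  fixes P :: "'k \<Rightarrow> nat \<Rightarrow> real" and n :: "nat \<Rightarrow> nat"
  assumes "\<forall>k\<in>set ks. (\<Sum>i = 1..D. P k i) = 1"
  shows "(\<Sum>v\<in>index_words D (length ks). prod_list (map2 P ks v)) = 1 \<and>
    (\<Sum>v\<in>index_words D (length ks). prod_list (map2 P ks v) * sum_list (map n v)) =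
      (\<Sum>k\<leftarrow>ks. \<Sum>i = 1..D. P k i * n i)"
  using assms
proof (induction ks)
  case (Cons k ks)
  define T where "T v = prod_list (map2 P ks v)" for v
  define L where "L v = real (sum_list (map n v))" for v
  have IH: "(\<Sum>v\<in>index_words D (length ks). T v) = 1"
    "(\<Sum>v\<in>index_words D (length ks). T v * L v) = (\<Sum>k\<leftarrow>ks. \<Sum>i = 1..D. P k i * n i)"
    using Cons by (auto simp: T_def L_def)
  have Pk: "(\<Sum>i = 1..D. P k i) = 1" using Cons.prems by simp
  have "(\<Sum>v\<in>index_words D (length (k # ks)). prod_list (map2 P (k # ks) v)) =
      (\<Sum>i = 1..D. P k i * (\<Sum>v\<in>index_words D (length ks). T v))"
    by (simp add: sum_index_words_Suc T_def sum_distrib_left)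
  then have 1: "(\<Sum>v\<in>index_words D (length (k # ks)). prod_list (map2 P (k # ks) v)) = 1"
    using IH(1) Pk by simp
  have "(\<Sum>v\<in>index_words D (length (k # ks)). prod_list (map2 P (k # ks) v) * sum_list (map n v)) =
      (\<Sum>i = 1..D. \<Sum>v\<in>index_words D (length ks). P k i * n i * T v + P k i * (T v * L v))"
    by (simp add: sum_index_words_Suc T_def L_def algebra_simps)
  also have "\<dots> = (\<Sum>i = 1..D. P k i * n i * (\<Sum>v\<in>index_words D (length ks). T v)
      + P k i * (\<Sum>v\<in>index_words D (length ks). T v * L v))"
    by (simp add: sum.distrib sum_distrib_left)
  also have "\<dots> = (\<Sum>k\<leftarrow>k # ks. \<Sum>i = 1..D. P k i * n i)"
    unfolding IH using Pk by (simp add: sum.distrib sum_distrib_right[symmetric])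
  finally show ?case using 1 by blast
qed simp

section \<open>Prefix-free strings as quantum codewords\<close>

text \<open>Unique decoding, for lists of equal length only: with one symbol and the empty codeword,
  lists of different lengths have the same concatenation.\<close>

lemma concat_map_prefix_free_inj:
  assumes pf: "\<forall>i\<in>I. \<forall>j\<in>I. \<forall>x. c j = c i @ x \<longrightarrow> i = j"
    and "length u = length v" "set u \<subseteq> I" "set v \<subseteq> I" "concat (map c u) = concat (map c v)"
  shows "u = v"
  using assms(2-)
proof (induction u v rule: list_induct2)
  case (Cons a u b v)
  then have "c a @ concat (map c u) = c b @ concat (map c v)" by simp
  then have "\<exists>x. c b = c a @ x \<or> c a = c b @ x" unfolding append_eq_append_conv2 by metis
  moreover have "a \<in> I" "b \<in> I" using Cons.prems by auto
  ultimately have "a = b" using pf by blast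
  then show ?case using Cons by simp
qed simp

lemma ket_jointly_orthonormal:
  assumes "\<forall>i\<in>{1..D}. \<forall>j\<in>{1..D}. \<forall>x. c j = c i @ x \<longrightarrow> i = j"
  shows "jointly_orthonormal D (\<lambda>i. ket (c i))"
proof -
  have "concat (map c v) = concat (map c v') \<longleftrightarrow> v = v'"
    if "v \<in> index_words D m" "v' \<in> index_words D m" for m v v'
    using concat_map_prefix_free_inj[OF assms, of v v'] that by (auto simp: index_words_def)
  then show ?thesis
    by (auto simp: jointly_orthonormal_def fock_concat_list_ket finite_support_fock_space)
       (auto simp: ket_def)
qed

lemma string_isometry_altdef:
  "string_isometry l c (e :: nat \<Rightarrow> 'd::finite fock) f =
    (\<lambda>w. \<Sum>i = 1..CARD('d) ^ l. braket (e i) f * ket (c i) w)"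
  by (simp add: string_isometry_def ketbra_def mult.commute)

lemma string_isometry_isometry:
  fixes e :: "nat \<Rightarrow> 'd::finite fock"
  assumes e: "orthonormal_basis l e" and c: "inj_on c {1..CARD('d) ^ l}"
  shows "isometry_on_tensor_power l (string_isometry l c e)"
proof -
  have on: "orthonormal_family {1..CARD('d) ^ l} e" "\<forall>i\<in>{1..CARD('d) ^ l}. e i \<in> tensor_power l"
    using e by (auto simp: orthonormal_basis_iff)
  have fs: "finite_support (e i)" if "i \<in> {1..CARD('d) ^ l}" for i using on that by blast
  have onc: "orthonormal_family {1..CARD('d) ^ l} (\<lambda>i. ket (c i))"
    using c by (auto simp: orthonormal_family_def inj_on_def) (auto simp: ket_def)
  show ?thesis unfolding isometry_on_tensor_power_def
  proof (intro conjI ballI allI)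
    fix f :: "'d fock" assume f: "f \<in> tensor_power l"
    show "string_isometry l c e f \<in> fock_space"
      unfolding string_isometry_altdef by (intro finite_support_fock_space finite_support_sum) simp
    fix g :: "'d fock" assume g: "g \<in> tensor_power l"
    show "string_isometry l c e (\<lambda>w. a * f w + b * g w) =
        (\<lambda>w. a * string_isometry l c e f w + b * string_isometry l c e g w)" for a b
    proof
      fix w
      have "string_isometry l c e (\<lambda>w. a * f w + b * g w) w =
          (\<Sum>i = 1..CARD('d) ^ l. a * (braket (e i) f * ket (c i) w) + b * (braket (e i) g * ket (c i) w))"
        unfolding string_isometry_altdef using fs
        by (intro sum.cong) (auto simp: braket_add_right algebra_simps)
      then show "string_isometry l c e (\<lambda>w. a * f w + b * g w) w =
          a * string_isometry l c e f w + b * string_isometry l c e g w"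
        by (simp add: string_isometry_altdef sum.distrib sum_distrib_left)
    qed
    have "braket f g = braket (\<lambda>w. \<Sum>i = 1..CARD('d) ^ l. braket (e i) f * e i w)
        (\<lambda>w. \<Sum>i = 1..CARD('d) ^ l. braket (e i) g * e i w)"
      using orthonormal_family_complete[OF on _ f] orthonormal_family_complete[OF on _ g] by simp
    also have "\<dots> = (\<Sum>i = 1..CARD('d) ^ l. cnj (braket (e i) f) * braket (e i) g)"
      by (rule orthonormal_family_norm[OF on(1)])
    also have "\<dots> = braket (string_isometry l c e f) (string_isometry l c e g)"
      unfolding string_isometry_altdef by (rule orthonormal_family_norm[OF onc, symmetric])
    finally show "braket (string_isometry l c e f) (string_isometry l c e g) = braket f g" by simp
  qed
qed

lemma huffman_constrained_special_block_code:
  fixes e :: "nat \<Rightarrow> 'd::finite fock"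
  assumes e: "orthonormal_basis l e" and c: "huffman_code {1..CARD('d) ^ l} p c"
  shows "constrained_special_block_code m l (\<lambda>k. string_isometry l c e)"
proof -
  have pf: "\<forall>i\<in>{1..CARD('d) ^ l}. \<forall>j\<in>{1..CARD('d) ^ l}. \<forall>x. c j = c i @ x \<longrightarrow> i = j"
    by (rule huffman_code_prefix_free[OF c])
  then have "inj_on c {1..CARD('d) ^ l}" by (auto simp: inj_on_def)
  moreover have "length_codeword (ket (c i))" for i
    unfolding length_codeword_def by (auto simp: ket_in_tensor_power) (simp add: ket_def)
  ultimately show ?thesis
    unfolding constrained_special_block_code_def
    using string_isometry_isometry[OF e] ket_jointly_orthonormal[OF pf] e
    by (auto simp: string_isometry_def)
qed

lemma length_codeword_lengths:
  assumes "\<forall>i\<in>I. length_codeword (\<psi> i)"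
  obtains n where "\<And>i. i \<in> I \<Longrightarrow> \<psi> i \<in> tensor_power (n i)"
  using assms unfolding length_codeword_def by metis

subsection \<open>Quantum sources\<close>

text \<open>With the event named, splitting a word becomes an intersection of events and marginals
  come from a partition of the space.\<close>

definition emission_event :: "'w measure \<Rightarrow> (nat \<Rightarrow> 'w \<Rightarrow> nat) \<Rightarrow> nat \<Rightarrow> nat list \<Rightarrow> 'w set" where
  "emission_event M X k ns = {\<omega> \<in> space M. \<forall>i<length ns. X (k + i + 1) \<omega> = ns ! i}"

lemma window_prob_eq: "window_prob M X k ns = measure M (emission_event M X k ns)"
  by (simp add: window_prob_def emission_event_def)

lemma emission_event_append:
  "emission_event M X k (us @ vs) = emission_event M X k us \<inter> emission_event M X (k + length us) vs"
  (is "?L = ?R")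
proof
  show "?L \<subseteq> ?R"
  proof
    fix \<omega> assume \<omega>: "\<omega> \<in> ?L"
    then have *: "\<And>i. i < length us + length vs \<Longrightarrow> X (k + i + 1) \<omega> = (us @ vs) ! i"
      by (simp add: emission_event_def)
    have "X (k + i + 1) \<omega> = us ! i" if "i < length us" for i
      using *[of i] that by (simp add: nth_append)
    moreover have "X (k + length us + i + 1) \<omega> = vs ! i" if "i < length vs" for i
      using *[of "length us + i"] that by (simp add: nth_append add.assoc)
    ultimately show "\<omega> \<in> ?R" using \<omega> by (simp add: emission_event_def)
  qed
  show "?R \<subseteq> ?L"
  proof
    fix \<omega> assume \<omega>: "\<omega> \<in> ?R"
    have "X (k + i + 1) \<omega> = (us @ vs) ! i" if "i < length us + length vs" for i
    proof (cases "i < length us")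
      case True
      then show ?thesis using \<omega> by (simp add: emission_event_def nth_append)
    next
      case False
      then obtain j where j: "i = length us + j" using le_Suc_ex not_less by blast
      then have "X (k + length us + j + 1) \<omega> = vs ! j"
        using \<omega> that by (simp add: emission_event_def)
      then show ?thesis by (simp add: j nth_append add.assoc)
    qed
    then show "\<omega> \<in> ?L" using \<omega> by (simp add: emission_event_def)
  qed
qed

text \<open>Stationarity is added later, where it identifies the window distributions; here block
  \<open>k\<close> of a message is governed by the window starting at
  \<open>(k - 1) * l\<close>.\<close>

locale source =
  fixes M :: "'w measure" and X :: "nat \<Rightarrow> 'w \<Rightarrow> nat" and N :: nat
    and s :: "nat \<Rightarrow> complex ^ 'd::finite"
  assumes source: "quantum_source M X N s"
begin

sublocale prob_space M using source by (simp add: quantum_source_def)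

abbreviation "p \<equiv> window_prob M X"
abbreviation "\<sigma> \<equiv> source_ket s"

lemma letter_range: "n \<ge> 1 \<Longrightarrow> \<omega> \<in> space M \<Longrightarrow> X n \<omega> \<in> {1..N}"
  using source measurable_space[of "X n" M "count_space {1..N}" \<omega>] by (auto simp: quantum_source_def)

lemma emission_event_sets [measurable]: "emission_event M X k ns \<in> sets M"
proof -
  have "X (k + i + 1) \<in> measurable M (count_space {1..N})" for i
    using source by (simp add: quantum_source_def)
  then have "{\<omega> \<in> space M. X (k + i + 1) \<omega> = j} \<in> sets M" for i j
    by measurable
  then show ?thesis unfolding emission_event_def by measurable
qed

lemma emission_event_partition:
  assumes "E \<in> sets M"
  shows "(\<Sum>us\<in>index_words N a. measure M (E \<inter> emission_event M X k us)) = measure M E"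
proof -
  have "disjoint_family_on (\<lambda>us. E \<inter> emission_event M X k us) (index_words N a)"
    unfolding disjoint_family_on_def
  proof (intro ballI impI)
    fix us vs assume "us \<in> index_words N a" "vs \<in> index_words N a" "us \<noteq> vs"
    then have "length us = length vs" "\<exists>i<length us. us ! i \<noteq> vs ! i"
      by (auto simp: index_words_def list_eq_iff_nth_eq)
    then show "(E \<inter> emission_event M X k us) \<inter> (E \<inter> emission_event M X k vs) = {}"
      by (auto simp: emission_event_def)
  qed
  then have "(\<Sum>us\<in>index_words N a. measure M (E \<inter> emission_event M X k us)) =
      measure M (\<Union>us\<in>index_words N a. E \<inter> emission_event M X k us)"
    using assms by (intro finite_measure_finite_Union[symmetric]) auto
  also have "(\<Union>us\<in>index_words N a. E \<inter> emission_event M X k us) = E"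
  proof
    show "E \<subseteq> (\<Union>us\<in>index_words N a. E \<inter> emission_event M X k us)"
    proof
      fix \<omega> assume "\<omega> \<in> E"
      then have \<omega>: "\<omega> \<in> space M" using assms sets.sets_into_space by blast
      define us where "us = map (\<lambda>i. X (k + i + 1) \<omega>) [0..<a]"
      have "us \<in> index_words N a"
        using letter_range \<omega> by (auto simp: us_def index_words_def)
      moreover have "\<omega> \<in> emission_event M X k us" using \<omega> by (simp add: us_def emission_event_def)
      ultimately show "\<omega> \<in> (\<Union>us\<in>index_words N a. E \<inter> emission_event M X k us)"
        using \<open>\<omega> \<in> E\<close> by blast
    qed
  qed blast
  finally show ?thesis .
qed

lemma window_prob_sum_right: "(\<Sum>vs\<in>index_words N b. p k (us @ vs)) = p k us"
  unfolding window_prob_eq emission_event_append by (rule emission_event_partition) simp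

lemma window_prob_sum_left: "(\<Sum>us\<in>index_words N a. p k (us @ vs)) = p (k + a) vs"
proof -
  have "(\<Sum>us\<in>index_words N a. p k (us @ vs)) =
      (\<Sum>us\<in>index_words N a. measure M (emission_event M X (k + a) vs \<inter> emission_event M X k us))"
    by (intro sum.cong) (auto simp: window_prob_eq emission_event_append index_words_def Int_commute)
  then show ?thesis by (simp add: emission_event_partition window_prob_eq)
qed

lemma window_prob_nonneg: "0 \<le> p k ns"
  by (simp add: window_prob_def)

lemma window_prob_total: "(\<Sum>us\<in>index_words N a. p k us) = 1"
  using emission_event_partition[where E = "space M" and a = a and k = k] sets.sets_into_space[OF emission_event_sets]
  by (simp add: window_prob_eq prob_space Int_absorb1)

lemma window_prob_marginal:
  "(\<Sum>ns\<in>index_words N (a + (b + c)). p 0 ns * g (take b (drop a ns))) =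
    (\<Sum>us\<in>index_words N b. p a us * g us)"
proof -
  have "(\<Sum>ns\<in>index_words N (a + (b + c)). p 0 ns * g (take b (drop a ns))) =
      (\<Sum>xs\<in>index_words N a. \<Sum>us\<in>index_words N b. \<Sum>vs\<in>index_words N c. p 0 ((xs @ us) @ vs) * g us)"
    unfolding sum_index_words_append by (intro sum.cong refl) (auto simp: index_words_def)
  also have "\<dots> = (\<Sum>xs\<in>index_words N a. \<Sum>us\<in>index_words N b. p 0 (xs @ us) * g us)"
    unfolding sum_distrib_right[symmetric] window_prob_sum_right ..
  also have "\<dots> = (\<Sum>us\<in>index_words N b. \<Sum>xs\<in>index_words N a. p 0 (xs @ us) * g us)"
    by (rule sum.swap)
  also have "\<dots> = (\<Sum>us\<in>index_words N b. p a us * g us)"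
    unfolding sum_distrib_right[symmetric] window_prob_sum_left by simp
  finally show ?thesis .
qed

lemma source_ket_in_tensor_power: "length ns = l \<Longrightarrow> \<sigma> ns \<in> tensor_power l"
  by (simp add: source_ket_def tensor_ket_in_tensor_power)

lemma source_ket_unit: "set ns \<subseteq> {1..N} \<Longrightarrow> braket (\<sigma> ns) (\<sigma> ns) = 1"
  unfolding source_ket_def using source
  by (intro tensor_ket_unit) (auto simp: quantum_source_def)

text \<open>The expectation of the ensemble state in \<open>f\<close>; for a unit vector, the
  probability of finding \<open>f\<close> in the emitted block. Unlike a \<open>braket\<close> it is
  real by definition.\<close>

definition weight :: "nat \<Rightarrow> 'd fock \<Rightarrow> real" where
  "weight l f = (\<Sum>us\<in>index_words N l. p 0 us * (cmod (braket f (\<sigma> us)))\<^sup>2)"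

lemma cmod_braket_commute: "cmod (braket f g) = cmod (braket g f)"
  by (metis braket_commute complex_mod_cnj)

lemma ensemble_state_eq: "ensemble_state M X N s l = ketbra_mixture (index_words N l) (p 0) \<sigma>"
  by (simp add: ensemble_state_def ketbra_mixture_def)

lemma source_kets: "us \<in> index_words N l \<Longrightarrow> \<sigma> us \<in> tensor_power l"
  by (simp add: index_words_def source_ket_in_tensor_power)

lemma weight_eq_quadratic_form:
  assumes "finite_support f"
  shows "braket f (ensemble_state M X N s l f) = of_real (weight l f)"
  unfolding ensemble_state_eq weight_def
  using ketbra_mixture_quadratic_form[of "index_words N l" \<sigma> l f, OF source_kets assms]
  by (simp add: cmod_braket_commute)

text \<open>For a fixed message the codeword indices behave like independent draws, one per block,
  with probabilities \<open>P ns k\<close>. As length is additive, averaging over messages only sees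
  the marginal of each block, and correlations between blocks drop out.\<close>

lemma avg_codeword_length_code:
  fixes e :: "nat \<Rightarrow> nat \<Rightarrow> 'd fock"
  assumes jo: "jointly_orthonormal (CARD('d) ^ l) \<psi>"
    and n: "\<And>i. i \<in> {1..CARD('d) ^ l} \<Longrightarrow> \<psi> i \<in> tensor_power (n i)"
    and e: "\<And>k. k \<in> {1..m} \<Longrightarrow> orthonormal_basis l (e k)"
    and U: "\<And>k f. k \<in> {1..m} \<Longrightarrow> f \<in> tensor_power l \<Longrightarrow>
        U k f = (\<lambda>w. \<Sum>i = 1..CARD('d) ^ l. ketbra (\<psi> i) (e k i) f w)"
    and m: "m \<ge> 1"
  shows "avg_codeword_length M X N s m l U =
    (\<Sum>k = 1..m. \<Sum>i = 1..CARD('d) ^ l. n i *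
      (\<Sum>us\<in>index_words N l. p ((k - 1) * l) us * (cmod (braket (e k i) (\<sigma> us)))\<^sup>2))"
proof -
  let ?D = "CARD('d) ^ l"
  define blk where "blk k ns = take l (drop ((k - 1) * l) ns)" for k and ns :: "nat list"
  define P where "P ns k i = (cmod (braket (e k i) (\<sigma> (blk k ns))))\<^sup>2" for ns k i
  \<comment> \<open>Letters before, inside and after block \<open>k\<close>.\<close>
  have blk_le: "(k - 1) * l + (l + (m - k) * l) = m * l" if "k \<in> {1..m}" for k
  proof -
    have "m = (k - 1) + (1 + (m - k))" using that by auto
    then show ?thesis by (metis add_mult_distrib mult_1)
  qed
  have trace: "Re (op_trace (ketbra (encoded_ket s m l U ns) (encoded_ket s m l U ns) \<circ> length_observable)) =
      (\<Sum>k = 1..m. \<Sum>i = 1..?D. P ns k i * n i)" if ns: "ns \<in> index_words N (m * l)" for ns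
  proof -
    define c where "c k i = braket (e k i) (\<sigma> (blk k ns))" for k i
    have blk: "length (blk k ns) = l" "set (blk k ns) \<subseteq> {1..N}" if "k \<in> {1..m}" for k
    proof -
      have "length ns = (k - 1) * l + (l + (m - k) * l)"
        using ns blk_le[OF that] by (simp add: index_words_def)
      then show "length (blk k ns) = l" by (simp add: blk_def)
      show "set (blk k ns) \<subseteq> {1..N}"
        using ns by (auto simp: blk_def index_words_def dest!: in_set_takeD in_set_dropD)
    qed
    have "encoded_ket s m l U ns =
        fock_concat_list (map (\<lambda>k w. \<Sum>i = 1..?D. c k i * \<psi> i w) [1..<m + 1])"
      unfolding encoded_ket_def
    proof (intro arg_cong[of _ _ fock_concat_list] map_cong refl)
      fix k assume "k \<in> set [1..<m + 1]"
      then have k: "k \<in> {1..m}" by auto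
      show "U k (\<sigma> (take l (drop ((k - 1) * l) ns))) = (\<lambda>w. \<Sum>i = 1..?D. c k i * \<psi> i w)"
        unfolding blk_def[symmetric] U[OF k source_ket_in_tensor_power[OF blk(1)[OF k]]]
        by (simp add: ketbra_def c_def mult.commute)
    qed
    also have "\<dots> = (\<lambda>w. \<Sum>v\<in>index_words ?D m. prod_list (map2 c [1..<m + 1] v) *
        fock_concat_list (map \<psi> v) w)"
      unfolding fock_concat_list_expand by (simp del: upt_Suc)
    finally have x: "encoded_ket s m l U ns = \<dots>" .
    have tp: "\<forall>v\<in>index_words ?D m. fock_concat_list (map \<psi> v) \<in> tensor_power (sum_list (map n v))"
      using n by (auto intro!: fock_concat_list_in_tensor_power simp: index_words_def subset_iff)
    have "Re (op_trace (ketbra (encoded_ket s m l U ns) (encoded_ket s m l U ns) \<circ> length_observable)) =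
        (\<Sum>v\<in>index_words ?D m. (cmod (prod_list (map2 c [1..<m + 1] v)))\<^sup>2 * sum_list (map n v))"
      using op_trace_length_observable_superposition[OF jointly_orthonormal_family[OF jo n m] tp x]
      by simp
    also have "\<dots> = (\<Sum>v\<in>index_words ?D m. prod_list (map2 (P ns) [1..<m + 1] v) * sum_list (map n v))"
    proof -
      have "(cmod (prod_list (map2 c ks v)))\<^sup>2 = prod_list (map2 (P ns) ks v)" for ks v
        by (induction ks v rule: list_induct2') (simp_all add: P_def c_def norm_mult power_mult_distrib)
      then show ?thesis by simp
    qed
    also have "\<dots> = (\<Sum>k\<leftarrow>[1..<m + 1]. \<Sum>i = 1..?D. P ns k i * n i)"
    proof -
      \<comment> \<open>Parseval: the squared amplitudes in block \<open>k\<close> form a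
        probability vector.\<close>
      have "(\<Sum>i = 1..?D. P ns k i) = 1" if "k \<in> set [1..<m + 1]" for k
      proof -
        have k: "k \<in> {1..m}" using that by auto
        have on: "orthonormal_family {1..?D} (e k)" "\<forall>i\<in>{1..?D}. e k i \<in> tensor_power l"
          using e[OF k] by (auto simp: orthonormal_basis_iff)
        have "(\<Sum>i = 1..?D. P ns k i) = Re (braket (\<sigma> (blk k ns)) (\<sigma> (blk k ns)))"
          unfolding P_def
          by (rule parseval[OF on]) (simp_all add: source_ket_in_tensor_power[OF blk(1)[OF k]])
        then show ?thesis using source_ket_unit[OF blk(2)[OF k]] by simp
      qed
      then show ?thesis using product_distribution_expected_sum[of "[1..<m + 1]" "P ns" ?D n]
        by (simp del: upt_Suc)
    qed
    also have "\<dots> = (\<Sum>k = 1..m. \<Sum>i = 1..?D. P ns k i * n i)"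
      by (simp add: interv_sum_list_conv_sum_set_nat atLeastLessThanSuc_atLeastAtMost del: upt_Suc)
    finally show ?thesis .
  qed
  have "avg_codeword_length M X N s m l U =
      (\<Sum>ns\<in>index_words N (m * l). \<Sum>k = 1..m. \<Sum>i = 1..?D. n i * (p 0 ns * P ns k i))"
    unfolding avg_codeword_length_def
    by (intro sum.cong refl) (simp add: trace sum_distrib_left mult_ac)
  also have "\<dots> = (\<Sum>k = 1..m. \<Sum>ns\<in>index_words N (m * l). \<Sum>i = 1..?D. n i * (p 0 ns * P ns k i))"
    by (rule sum.swap)
  also have "\<dots> = (\<Sum>k = 1..m. \<Sum>i = 1..?D. \<Sum>ns\<in>index_words N (m * l). n i * (p 0 ns * P ns k i))"
    by (intro sum.cong refl sum.swap)
  also have "\<dots> = (\<Sum>k = 1..m. \<Sum>i = 1..?D. n i *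
      (\<Sum>us\<in>index_words N l. p ((k - 1) * l) us * (cmod (braket (e k i) (\<sigma> us)))\<^sup>2))"
  proof (intro sum.cong refl)
    fix k i assume "k \<in> {1..m}"
    from window_prob_marginal[where a = "(k - 1) * l" and b = l and c = "(m - k) * l"
        and g = "\<lambda>us. (cmod (braket (e k i) (\<sigma> us)))\<^sup>2"]
    have "(\<Sum>ns\<in>index_words N (m * l). p 0 ns * P ns k i) =
        (\<Sum>us\<in>index_words N l. p ((k - 1) * l) us * (cmod (braket (e k i) (\<sigma> us)))\<^sup>2)"
      unfolding blk_le[OF \<open>k \<in> {1..m}\<close>] P_def blk_def .
    then show "(\<Sum>ns\<in>index_words N (m * l). n i * (p 0 ns * P ns k i)) = n i *
        (\<Sum>us\<in>index_words N l. p ((k - 1) * l) us * (cmod (braket (e k i) (\<sigma> us)))\<^sup>2)"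
      by (simp add: sum_distrib_left[symmetric])
  qed
  finally show ?thesis .
qed

section \<open>Eigenvalues and entropy of the ensemble state\<close>

context
  fixes l :: nat and lam :: "nat \<Rightarrow> real" and e :: "nat \<Rightarrow> 'd fock"
  assumes sd: "spectral_decomposition l (ensemble_state M X N s l) lam e"
begin

lemma eigenbasis:
  "orthonormal_family {1..CARD('d) ^ l} e" "\<forall>i\<in>{1..CARD('d) ^ l}. e i \<in> tensor_power l"
  using sd by (auto simp: spectral_decomposition_def orthonormal_basis_iff)

text \<open>The quadratic form of the ensemble state, evaluated on its mixture over the
  eigenvectors. The squared overlaps are the rows of the doubly stochastic matrix used
  below.\<close>

lemma weight_eq_mixture:
  assumes f: "f \<in> tensor_power l"
  shows "weight l f = (\<Sum>j = 1..CARD('d) ^ l. (cmod (braket (e j) f))\<^sup>2 * lam j)"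
proof -
  have fs: "finite_support f" using f by blast
  have "of_real (weight l f) = braket f (ensemble_state M X N s l f)"
    by (simp add: weight_eq_quadratic_form[OF fs])
  also have "\<dots> = braket f (ketbra_mixture {1..CARD('d) ^ l} lam e f)"
    using sd f by (simp add: spectral_decomposition_def ketbra_mixture_def)
  also have "\<dots> = of_real (\<Sum>j = 1..CARD('d) ^ l. lam j * (cmod (braket (e j) f))\<^sup>2)"
    by (rule ketbra_mixture_quadratic_form[where l = l]) (use eigenbasis fs in auto)
  finally have "weight l f = (\<Sum>j = 1..CARD('d) ^ l. lam j * (cmod (braket (e j) f))\<^sup>2)"
    by (simp only: of_real_eq_iff)
  then show ?thesis by (simp add: mult.commute)
qed

lemma eigenvalue_eq_weight:
  assumes "i \<in> {1..CARD('d) ^ l}"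
  shows "lam i = weight l (e i)"
proof -
  have "weight l (e i) = (\<Sum>j = 1..CARD('d) ^ l. if j = i then lam i else 0)"
    unfolding weight_eq_mixture[OF eigenbasis(2)[rule_format, OF assms]]
    using eigenbasis(1) assms by (intro sum.cong) (auto simp: orthonormal_family_def)
  then show ?thesis using assms by simp
qed

lemma eigenvalue_nonneg: "\<forall>i\<in>{1..CARD('d) ^ l}. 0 \<le> lam i"
  by (auto simp: eigenvalue_eq_weight weight_def window_prob_nonneg intro!: sum_nonneg)

text \<open>The trace: each source ket spreads total mass 1 over the eigenbasis.\<close>

lemma eigenvalue_sum: "(\<Sum>i = 1..CARD('d) ^ l. lam i) = 1"
proof -
  have "(\<Sum>i = 1..CARD('d) ^ l. lam i) =
      (\<Sum>i = 1..CARD('d) ^ l. \<Sum>us\<in>index_words N l. p 0 us * (cmod (braket (e i) (\<sigma> us)))\<^sup>2)"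
    by (intro sum.cong) (auto simp: eigenvalue_eq_weight weight_def)
  also have "\<dots> = (\<Sum>us\<in>index_words N l. p 0 us * (\<Sum>i = 1..CARD('d) ^ l. (cmod (braket (e i) (\<sigma> us)))\<^sup>2))"
    unfolding sum_distrib_left by (rule sum.swap)
  also have "\<dots> = (\<Sum>us\<in>index_words N l. p 0 us)"
  proof (rule sum.cong[OF refl])
    fix us assume "us \<in> index_words N l"
    then have "(\<Sum>i = 1..CARD('d) ^ l. (cmod (braket (e i) (\<sigma> us)))\<^sup>2) = 1"
      using parseval[OF eigenbasis _ source_kets] source_ket_unit by (simp add: index_words_def)
    then show "p 0 us * (\<Sum>i = 1..CARD('d) ^ l. (cmod (braket (e i) (\<sigma> us)))\<^sup>2) = p 0 us" by simp
  qed
  finally show ?thesis by (simp add: window_prob_total)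
qed

text \<open>
  The weights of any orthonormal basis are a doubly stochastic image of the eigenvalues.
\<close>

lemma huffman_cost_le_weights:
  assumes huff: "huffman_code {1..CARD('d) ^ l} lam c"
    and f: "orthonormal_family A f" "\<forall>a\<in>A. f a \<in> tensor_power l" and card: "card A = CARD('d) ^ l"
    and kraft: "(\<Sum>a\<in>A. (1/2::real) ^ n a) \<le> 1"
  shows "(\<Sum>i = 1..CARD('d) ^ l. lam i * length (c i)) \<le> (\<Sum>a\<in>A. n a * weight l (f a))"
proof -
  have "(\<Sum>i = 1..CARD('d) ^ l. lam i * length (c i)) \<le>
      (\<Sum>a\<in>A. n a * (\<Sum>j = 1..CARD('d) ^ l. (cmod (braket (e j) (f a)))\<^sup>2 * lam j))"
  proof (rule huffman_code_le_doubly_stochastic[OF huff eigenvalue_nonneg _ _ kraft])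
    \<comment> \<open>The matrix holds the squared overlaps: rows sum to 1 by Parseval in the
      eigenbasis, columns by Parseval in \<open>f\<close>.\<close>
    show "\<forall>a\<in>A. (\<Sum>j = 1..CARD('d) ^ l. (cmod (braket (e j) (f a)))\<^sup>2) = 1"
      using parseval[OF eigenbasis _ f(2)[rule_format]] f(1) by (auto simp: orthonormal_family_def)
    show "\<forall>j\<in>{1..CARD('d) ^ l}. (\<Sum>a\<in>A. (cmod (braket (e j) (f a)))\<^sup>2) = 1"
      using parseval[OF f card eigenbasis(2)[rule_format]] eigenbasis(1)
      by (auto simp: orthonormal_family_def cmod_braket_commute)
  qed (use f card in \<open>auto simp: orthonormal_family_def\<close>)
  also have "\<dots> = (\<Sum>a\<in>A. n a * weight l (f a))"
    using f by (intro sum.cong) (auto simp: weight_eq_mixture)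
  finally show ?thesis .
qed

end

lemma ensemble_spectral_decomposition:
  "\<exists>lam e. spectral_decomposition l (ensemble_state M X N s l) lam e"
  unfolding ensemble_state_eq
  by (rule ketbra_mixture_spectral_decomposition) (rule source_kets)

text \<open>The decomposition chosen inside \<open>op_log2\<close> is handed out together with the
  formula, so that the cost bounds can be applied to that very one.\<close>

lemma von_neumann_entropy_eq:
  obtains lam e where "spectral_decomposition l (ensemble_state M X N s l) lam e"
    "von_neumann_entropy l (ensemble_state M X N s l) =
      - (\<Sum>i = 1..CARD('d) ^ l. lam i * log 2 (lam i))"
proof -
  let ?A = "ensemble_state M X N s l" and ?D = "CARD('d) ^ l"
  let ?B = "\<lambda>lam e f w. \<Sum>i = 1..?D. of_real (log 2 (lam i)) * ketbra (e i) (e i) f w"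
  have "\<exists>B lam e. spectral_decomposition l ?A lam e \<and> B = ?B lam e"
    using ensemble_spectral_decomposition by blast
  then have "\<exists>lam e. spectral_decomposition l ?A lam e \<and> op_log2 l ?A = ?B lam e"
    unfolding op_log2_def by (rule someI_ex)
  then obtain lam e where sd: "spectral_decomposition l ?A lam e" and B: "op_log2 l ?A = ?B lam e"
    by blast
  note e = eigenbasis[OF sd]
  have el: "e i w = 0" if "i \<in> {1..?D}" "length w \<noteq> l" for i w
    using e(2) that unfolding tensor_power_def by blast
  have AB: "(?A \<circ> op_log2 l ?A) (ket w) w =
      (\<Sum>i = 1..?D. of_real (lam i * log 2 (lam i)) * (cnj (e i w) * e i w))" for w
  proof -
    have Bw: "op_log2 l ?A (ket w) = (\<lambda>v. \<Sum>i = 1..?D. (of_real (log 2 (lam i)) * cnj (e i w)) * e i v)"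
      unfolding B by (simp add: ketbra_def mult_ac)
    \<comment> \<open>The trace runs over kets of every length, while
      \<open>spectral_decomposition\<close> describes \<open>?A\<close> on the tensor power only;
      the image of each ket is therefore placed there first.\<close>
    have "op_log2 l ?A (ket w) \<in> tensor_power l"
      unfolding Bw using e(2) by (intro tensor_power_sum) auto
    then have "?A (op_log2 l ?A (ket w)) w =
        (\<Sum>i = 1..?D. of_real (lam i) * (e i w * braket (e i) (op_log2 l ?A (ket w))))"
      using sd by (simp add: spectral_decomposition_def ketbra_def)
    also have "\<dots> = (\<Sum>i = 1..?D. of_real (lam i) * (e i w * (of_real (log 2 (lam i)) * cnj (e i w))))"
      unfolding Bw using orthonormal_family_coefficient[OF e(1)] by (intro sum.cong refl) simp
    finally show ?thesis by (simp add: mult_ac)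
  qed
  have "op_trace (?A \<circ> op_log2 l ?A) =
      (\<Sum>\<^sub>\<infinity>w. \<Sum>i = 1..?D. of_real (lam i * log 2 (lam i)) * (cnj (e i w) * e i w))"
    unfolding op_trace_def braket_ket_left AB ..
  also have "\<dots> = (\<Sum>w | length w = l. \<Sum>i = 1..?D. of_real (lam i * log 2 (lam i)) * (cnj (e i w) * e i w))"
    by (rule infsum_eq_finite_sum) (auto simp: el)
  also have "\<dots> = (\<Sum>i = 1..?D. \<Sum>w | length w = l. of_real (lam i * log 2 (lam i)) * (cnj (e i w) * e i w))"
    by (rule sum.swap)
  also have "\<dots> = (\<Sum>i = 1..?D. of_real (lam i * log 2 (lam i)))"
  proof (rule sum.cong[OF refl])
    fix i assume i: "i \<in> {1..?D}"
    have "(\<Sum>w | length w = l. cnj (e i w) * e i w) = braket (e i) (e i)"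
      using e(2) i braket_tensor_power[of "e i" l "e i"] by simp
    also have "\<dots> = 1" using e(1) i by (auto simp: orthonormal_family_def)
    finally show "(\<Sum>w | length w = l. of_real (lam i * log 2 (lam i)) * (cnj (e i w) * e i w)) =
        complex_of_real (lam i * log 2 (lam i))"
      by (simp add: sum_distrib_left[symmetric])
  qed
  finally have "von_neumann_entropy l ?A = - (\<Sum>i = 1..?D. lam i * log 2 (lam i))"
    by (simp add: von_neumann_entropy_def)
  then show thesis using that sd by blast
qed

end

subsection \<open>Stationary sources\<close>

locale stationary_source = source M X N s
  for M :: "'w measure" and X :: "nat \<Rightarrow> 'w \<Rightarrow> nat" and N :: nat
    and s :: "nat \<Rightarrow> complex ^ 'd::finite" +
  assumes stationary: "stationary_process M X N"
begin

lemma window_prob_shift: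
  assumes "l \<ge> 1" "us \<in> index_words N l"
  shows "p k us = p 0 us"
proof (cases "k = 0")
  case False
  then have "k \<ge> 1" "length us \<ge> 1" "set us \<subseteq> {1..N}" using assms by (auto simp: index_words_def)
  then show ?thesis using stationary unfolding stationary_process_def by metis
qed simp

lemma window_sum_shift:
  assumes "l \<ge> 1"
  shows "(\<Sum>us\<in>index_words N l. p k us * g us) = (\<Sum>us\<in>index_words N l. p 0 us * g us)"
  by (intro sum.cong refl arg_cong2[where f = "(*)"] window_prob_shift[OF assms])

lemma avg_codeword_length_weights:
  fixes e :: "nat \<Rightarrow> nat \<Rightarrow> 'd fock"
  assumes "jointly_orthonormal (CARD('d) ^ l) \<psi>"
    and "\<And>i. i \<in> {1..CARD('d) ^ l} \<Longrightarrow> \<psi> i \<in> tensor_power (n i)"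
    and "\<And>k. k \<in> {1..m} \<Longrightarrow> orthonormal_basis l (e k)"
    and "\<And>k f. k \<in> {1..m} \<Longrightarrow> f \<in> tensor_power l \<Longrightarrow>
        U k f = (\<lambda>w. \<Sum>i = 1..CARD('d) ^ l. ketbra (\<psi> i) (e k i) f w)"
    and "m \<ge> 1" "l \<ge> 1"
  shows "avg_codeword_length M X N s m l U =
    (\<Sum>k = 1..m. \<Sum>i = 1..CARD('d) ^ l. n i * weight l (e k i))"
proof -
  from assms(1-5) have "avg_codeword_length M X N s m l U =
      (\<Sum>k = 1..m. \<Sum>i = 1..CARD('d) ^ l. n i *
        (\<Sum>us\<in>index_words N l. p ((k - 1) * l) us * (cmod (braket (e k i) (\<sigma> us)))\<^sup>2))"
    by (rule avg_codeword_length_code)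
  then show ?thesis
    by (simp only: weight_def window_sum_shift[OF assms(6), where k = "(_ - 1) * l"])
qed

lemma avg_codeword_length_huffman:
  fixes lam :: "nat \<Rightarrow> real"
  assumes sd: "spectral_decomposition l (ensemble_state M X N s l) lam e"
    and huff: "huffman_code {1..CARD('d) ^ l} lam c" and ml: "m \<ge> 1" "l \<ge> 1"
  shows "avg_codeword_length M X N s m l (\<lambda>k. string_isometry l c e) =
    m * (\<Sum>i = 1..CARD('d) ^ l. lam i * length (c i))"
proof -
  have "avg_codeword_length M X N s m l (\<lambda>k. string_isometry l c e) =
      (\<Sum>k = 1..m. \<Sum>i = 1..CARD('d) ^ l. length (c i) * weight l (e i))"
    by (rule avg_codeword_length_weights[OF ket_jointly_orthonormal[OF huffman_code_prefix_free[OF huff]]])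
       (use sd ml in \<open>auto simp: ket_in_tensor_power spectral_decomposition_def string_isometry_def\<close>)
  also have "(\<Sum>i = 1..CARD('d) ^ l. length (c i) * weight l (e i)) =
      (\<Sum>i = 1..CARD('d) ^ l. lam i * length (c i))"
    by (intro sum.cong) (auto simp: eigenvalue_eq_weight[OF sd])
  finally show ?thesis by simp
qed

text \<open>All blocks share the codewords, hence one length function and one Kraft inequality. The
  bases may vary with the block, but the bound for a single block holds for every basis.\<close>

lemma avg_codeword_length_lower_bound:
  fixes lam :: "nat \<Rightarrow> real"
  assumes sd: "spectral_decomposition l (ensemble_state M X N s l) lam e"
    and huff: "huffman_code {1..CARD('d) ^ l} lam c" and ml: "m \<ge> 1" "l \<ge> 1"
    and U: "constrained_special_block_code m l U"
  shows "m * (\<Sum>i = 1..CARD('d) ^ l. lam i * length (c i)) \<le> avg_codeword_length M X N s m l U"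
proof -
  let ?D = "CARD('d) ^ l" and ?C = "\<Sum>i = 1..CARD('d) ^ l. lam i * length (c i)"
  obtain \<psi> where \<psi>: "jointly_orthonormal ?D \<psi>" "\<forall>i\<in>{1..?D}. length_codeword (\<psi> i)"
    and "\<forall>k\<in>{1..m}. \<exists>e. orthonormal_basis l e \<and>
      (\<forall>f\<in>tensor_power l. U k f = (\<lambda>w. \<Sum>i = 1..?D. ketbra (\<psi> i) (e i) f w))"
    using U unfolding constrained_special_block_code_def by blast
  from bchoice[OF this(3)] obtain b where b': "\<forall>k\<in>{1..m}. orthonormal_basis l (b k) \<and>
      (\<forall>f\<in>tensor_power l. U k f = (\<lambda>w. \<Sum>i = 1..?D. ketbra (\<psi> i) (b k i) f w))"
    by blast
  have b: "\<And>k. k \<in> {1..m} \<Longrightarrow> orthonormal_basis l (b k)"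
    "\<And>k f. k \<in> {1..m} \<Longrightarrow> f \<in> tensor_power l \<Longrightarrow>
      U k f = (\<lambda>w. \<Sum>i = 1..?D. ketbra (\<psi> i) (b k i) f w)"
    using b' by blast+
  obtain n where n: "\<And>i. i \<in> {1..?D} \<Longrightarrow> \<psi> i \<in> tensor_power (n i)"
    using length_codeword_lengths[OF \<psi>(2)] by blast
  have kraft: "(\<Sum>i = 1..?D. (1/2::real) ^ n i) \<le> 1" by (rule jointly_orthonormal_kraft[OF \<psi>(1) n])
  have "(\<Sum>k = 1..m. ?C) \<le> (\<Sum>k = 1..m. \<Sum>i = 1..?D. n i * weight l (b k i))"
  proof (rule sum_mono)
    fix k assume "k \<in> {1..m}"
    then have "orthonormal_basis l (b k)" by (rule b)
    then show "?C \<le> (\<Sum>i = 1..?D. n i * weight l (b k i))"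
      by (intro huffman_cost_le_weights[OF sd huff _ _ _ kraft]) (auto simp: orthonormal_basis_iff)
  qed
  also have "\<dots> = avg_codeword_length M X N s m l U"
    by (rule avg_codeword_length_weights[OF \<psi>(1) n b ml, symmetric])
  finally show ?thesis by simp
qed

text \<open>The infimum is attained, which gives one value for every spectral decomposition and
  every Huffman run, however eigenvalues coincide or ties are broken.\<close>

lemma ILC_eq_huffman_cost:
  fixes lam :: "nat \<Rightarrow> real"
  assumes sd: "spectral_decomposition l (ensemble_state M X N s l) lam e"
    and huff: "huffman_code {1..CARD('d) ^ l} lam c" and ml: "m \<ge> 1" "l \<ge> 1"
  shows "ILC M X N s m l = m * (\<Sum>i = 1..CARD('d) ^ l. lam i * length (c i))"
  unfolding ILC_def
proof (rule cInf_eq_minimum)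
  have "constrained_special_block_code m l (\<lambda>k. string_isometry l c e)"
    using sd by (intro huffman_constrained_special_block_code[OF _ huff])
      (simp add: spectral_decomposition_def)
  then show "m * (\<Sum>i = 1..CARD('d) ^ l. lam i * length (c i)) \<in>
      avg_codeword_length M X N s m l ` {U. constrained_special_block_code m l U}"
    using avg_codeword_length_huffman[OF assms] by (metis image_eqI mem_Collect_eq)
qed (use avg_codeword_length_lower_bound[OF assms] in blast)

section \<open>Subadditivity of the cost and the entropy rate\<close>

lemma ILC_near_entropy:
  assumes l: "l \<ge> 1"
  shows "von_neumann_entropy l (ensemble_state M X N s l) \<le> ILC M X N s 1 l"
    "ILC M X N s 1 l \<le> von_neumann_entropy l (ensemble_state M X N s l) + 2"
proof -
  obtain lam e where sd: "spectral_decomposition l (ensemble_state M X N s l) lam e"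
    and S: "von_neumann_entropy l (ensemble_state M X N s l) =
      - (\<Sum>i = 1..CARD('d) ^ l. lam i * log 2 (lam i))"
    by (rule von_neumann_entropy_eq)
  obtain c where huff: "huffman_code {1..CARD('d) ^ l} lam c"
    using huffman_code_exists[of "{1..CARD('d) ^ l}" lam] by (auto simp: Suc_le_eq)
  have ILC: "ILC M X N s 1 l = (\<Sum>i = 1..CARD('d) ^ l. lam i * length (c i))"
    using ILC_eq_huffman_cost[OF sd huff _ l, of 1] by simp
  note lam = eigenvalue_nonneg[OF sd] eigenvalue_sum[OF sd]
  show "von_neumann_entropy l (ensemble_state M X N s l) \<le> ILC M X N s 1 l"
    unfolding S ILC using lam huffman_code_kraft[OF huff] by (intro entropy_le_kraft_cost) auto
  obtain n where "(\<Sum>i = 1..CARD('d) ^ l. (1/2::real) ^ n i) \<le> 1"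
    "(\<Sum>i = 1..CARD('d) ^ l. lam i * real (n i)) \<le> 2 - (\<Sum>i = 1..CARD('d) ^ l. lam i * log 2 (lam i))"
    using kraft_cost_near_entropy[OF _ lam] by blast
  then show "ILC M X N s 1 l \<le> von_neumann_entropy l (ensemble_state M X N s l) + 2"
    unfolding S ILC using huffman_code_optimal[OF huff lam(1), of n] by linarith
qed

text \<open>
  Product bases with added codeword lengths compete for the longer block, and by stationarity the
  second block has the same weights as the first one of its length.
\<close>

lemma ILC_subadditive:
  assumes ab: "a \<ge> 1" "b \<ge> 1"
  shows "ILC M X N s 1 (a + b) \<le> ILC M X N s 1 a + ILC M X N s 1 b"
proof -
  have ex: "\<exists>lam e c. spectral_decomposition l (ensemble_state M X N s l) lam e \<and>
      huffman_code {1..CARD('d) ^ l} lam c" for l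
    using ensemble_spectral_decomposition[of l] huffman_code_exists[of "{1..CARD('d) ^ l}"]
    by (auto simp: Suc_le_eq)
  obtain lam e c where 1: "spectral_decomposition a (ensemble_state M X N s a) lam e"
    "huffman_code {1..CARD('d) ^ a} lam c" using ex by blast
  obtain lam' e' c' where 2: "spectral_decomposition b (ensemble_state M X N s b) lam' e'"
    "huffman_code {1..CARD('d) ^ b} lam' c'" using ex by blast
  obtain lam3 e3 c3 where 3: "spectral_decomposition (a + b) (ensemble_state M X N s (a + b)) lam3 e3"
    "huffman_code {1..CARD('d) ^ (a + b)} lam3 c3" using ex by blast
  note e = eigenbasis[OF 1(1)] and e' = eigenbasis[OF 2(1)]
  let ?I = "{1..CARD('d) ^ a}" and ?J = "{1..CARD('d) ^ b}"
  define f where "f = (\<lambda>(i, j). fock_concat (e i) (e' j))"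
  define n where "n = (\<lambda>(i, j). length (c i) + length (c' j))"
  have f: "\<forall>z\<in>?I \<times> ?J. f z \<in> tensor_power (a + b)"
    using e(2) e'(2) by (auto simp: f_def intro!: fock_concat_in_tensor_power)
  have "orthonormal_family (?I \<times> ?J) f"
    unfolding orthonormal_family_def
  proof (intro conjI ballI)
    show "finite_support (f z)" if "z \<in> ?I \<times> ?J" for z using f that by blast
    show "braket (f y) (f z) = (if y = z then 1 else 0)" if yz: "y \<in> ?I \<times> ?J" "z \<in> ?I \<times> ?J" for y z
    proof -
      obtain i j i' j' where ij: "y = (i, j)" "z = (i', j')" by (metis surj_pair)
      have "braket (f y) (f z) = braket (e i) (e i') * braket (e' j) (e' j')"
        unfolding f_def ij prod.case using yz e(2) e'(2) ij
        by (intro braket_fock_concat[where a = a and b = b]) auto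
      moreover have "braket (e i) (e i') = (if i = i' then 1 else 0)"
        using e(1) yz ij by (simp add: orthonormal_family_def)
      moreover have "braket (e' j) (e' j') = (if j = j' then 1 else 0)"
        using e'(1) yz ij by (simp add: orthonormal_family_def)
      ultimately show ?thesis using ij by simp
    qed
  qed simp
  moreover have "card (?I \<times> ?J) = CARD('d) ^ (a + b)" by (simp add: card_cartesian_product power_add)
  moreover have "(\<Sum>z\<in>?I \<times> ?J. (1/2::real) ^ n z) \<le> 1"
  proof -
    have "(\<Sum>z\<in>?I \<times> ?J. (1/2::real) ^ n z) =
        (\<Sum>i\<in>?I. (1/2) ^ length (c i)) * (\<Sum>j\<in>?J. (1/2) ^ length (c' j))"
      unfolding sum_product sum.cartesian_product by (intro sum.cong) (auto simp: n_def power_add)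
    then show ?thesis using huffman_code_kraft[OF 1(2)] huffman_code_kraft[OF 2(2)] by simp
  qed
  ultimately have "ILC M X N s 1 (a + b) \<le> (\<Sum>z\<in>?I \<times> ?J. n z * weight (a + b) (f z))"
    using huffman_cost_le_weights[OF 3 _ f, of n] ILC_eq_huffman_cost[OF 3, of 1] ab by simp
  also have "\<dots> = ILC M X N s 1 a + ILC M X N s 1 b"
  proof -
    define P where "P i us = (cmod (braket (e i) (\<sigma> us)))\<^sup>2" for i us
    define P' where "P' j vs = (cmod (braket (e' j) (\<sigma> vs)))\<^sup>2" for j vs
    \<comment> \<open>\<open>F\<close> and \<open>F'\<close> are the expected codeword lengths of
      the two halves for a fixed message. They add up in \<open>inner\<close> because the squared
      amplitudes of the other half sum to 1.\<close>
    define F where "F us = (\<Sum>i\<in>?I. length (c i) * P i us)" for us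
    define F' where "F' vs = (\<Sum>j\<in>?J. length (c' j) * P' j vs)" for vs
    have P1: "(\<Sum>i\<in>?I. P i us) = 1" if "us \<in> index_words N a" for us
      unfolding P_def using parseval[OF e _ source_kets[OF that]] that source_ket_unit
      by (simp add: index_words_def)
    have P'1: "(\<Sum>j\<in>?J. P' j vs) = 1" if "vs \<in> index_words N b" for vs
      unfolding P'_def using parseval[OF e' _ source_kets[OF that]] that source_ket_unit
      by (simp add: index_words_def)
    have w: "weight (a + b) (f (i, j)) =
        (\<Sum>us\<in>index_words N a. \<Sum>vs\<in>index_words N b. p 0 (us @ vs) * (P i us * P' j vs))"
      if "i \<in> ?I" "j \<in> ?J" for i j
      unfolding weight_def sum_index_words_append
    proof (intro sum.cong refl)
      fix us vs assume us: "us \<in> index_words N a" and vs: "vs \<in> index_words N b"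
      have "braket (f (i, j)) (\<sigma> (us @ vs)) = braket (e i) (\<sigma> us) * braket (e' j) (\<sigma> vs)"
        unfolding f_def source_ket_def map_append tensor_ket_append prod.case
        using e(2) e'(2) that source_kets[OF us] source_kets[OF vs]
        by (intro braket_fock_concat) (auto simp: source_ket_def)
      then show "p 0 (us @ vs) * (cmod (braket (f (i, j)) (\<sigma> (us @ vs))))\<^sup>2 =
          p 0 (us @ vs) * (P i us * P' j vs)"
        by (simp add: P_def P'_def norm_mult power_mult_distrib)
    qed
    have inner: "(\<Sum>i\<in>?I. \<Sum>j\<in>?J. real (length (c i) + length (c' j)) * (P i us * P' j vs)) = F us + F' vs"
      if "us \<in> index_words N a" "vs \<in> index_words N b" for us vs
    proof -
      have "(\<Sum>i\<in>?I. \<Sum>j\<in>?J. real (length (c i) + length (c' j)) * (P i us * P' j vs)) =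
          (\<Sum>i\<in>?I. \<Sum>j\<in>?J. (length (c i) * P i us) * P' j vs) +
          (\<Sum>i\<in>?I. \<Sum>j\<in>?J. P i us * (length (c' j) * P' j vs))"
        by (simp add: sum.distrib[symmetric] algebra_simps)
      also have "\<dots> = F us * (\<Sum>j\<in>?J. P' j vs) + (\<Sum>i\<in>?I. P i us) * F' vs"
        by (simp only: sum_product F_def F'_def)
      finally show ?thesis using P1 P'1 that by simp
    qed
    have "(\<Sum>z\<in>?I \<times> ?J. n z * weight (a + b) (f z)) =
        (\<Sum>i\<in>?I. \<Sum>j\<in>?J. \<Sum>us\<in>index_words N a. \<Sum>vs\<in>index_words N b.
          p 0 (us @ vs) * (real (length (c i) + length (c' j)) * (P i us * P' j vs)))"
      unfolding sum.cartesian_product[symmetric]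
      by (subst sum.cartesian_product, rule sum.cong)
         (auto simp: w n_def sum_distrib_left mult_ac simp del: of_nat_add)
    also have "\<dots> = (\<Sum>us\<in>index_words N a. \<Sum>vs\<in>index_words N b. \<Sum>i\<in>?I. \<Sum>j\<in>?J.
          p 0 (us @ vs) * (real (length (c i) + length (c' j)) * (P i us * P' j vs)))"
      unfolding sum.cartesian_product
      by (rule sum.reindex_bij_witness[of _ "\<lambda>(us, vs, i, j). (i, j, us, vs)"
            "\<lambda>(i, j, us, vs). (us, vs, i, j)"]) auto
    also have "\<dots> = (\<Sum>us\<in>index_words N a. \<Sum>vs\<in>index_words N b. p 0 (us @ vs) * (F us + F' vs))"
      by (intro sum.cong refl) (simp only: sum_distrib_left[symmetric] inner)
    also have "\<dots> = (\<Sum>us\<in>index_words N a. \<Sum>vs\<in>index_words N b. p 0 (us @ vs) * F us) +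
        (\<Sum>us\<in>index_words N a. \<Sum>vs\<in>index_words N b. p 0 (us @ vs) * F' vs)"
      by (simp add: distrib_left sum.distrib)
    also have "(\<Sum>us\<in>index_words N a. \<Sum>vs\<in>index_words N b. p 0 (us @ vs) * F' vs) =
        (\<Sum>vs\<in>index_words N b. \<Sum>us\<in>index_words N a. p 0 (us @ vs) * F' vs)"
      by (rule sum.swap)
    \<comment> \<open>Each half is averaged over its own marginal. That of the second half is the
      window starting at \<open>0 + a\<close>, which stationarity moves to 0.\<close>
    also have "(\<Sum>us\<in>index_words N a. \<Sum>vs\<in>index_words N b. p 0 (us @ vs) * F us) +
        (\<Sum>vs\<in>index_words N b. \<Sum>us\<in>index_words N a. p 0 (us @ vs) * F' vs) =
        (\<Sum>us\<in>index_words N a. p 0 us * F us) + (\<Sum>vs\<in>index_words N b. p 0 vs * F' vs)"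
      unfolding sum_distrib_right[symmetric] window_prob_sum_right window_prob_sum_left
        window_sum_shift[OF ab(2), of "0 + a"] ..
    also have "(\<Sum>us\<in>index_words N a. p 0 us * F us) = ILC M X N s 1 a"
    proof -
      have "(\<Sum>us\<in>index_words N a. p 0 us * F us) = (\<Sum>i\<in>?I. length (c i) * weight a (e i))"
        unfolding F_def weight_def P_def sum_distrib_left by (subst sum.swap) (simp add: mult_ac)
      also have "\<dots> = (\<Sum>i\<in>?I. lam i * length (c i))"
        by (intro sum.cong) (auto simp: eigenvalue_eq_weight[OF 1(1)])
      finally show ?thesis using ILC_eq_huffman_cost[OF 1, of 1] ab by simp
    qed
    also have "(\<Sum>vs\<in>index_words N b. p 0 vs * F' vs) = ILC M X N s 1 b"
    proof -
      have "(\<Sum>vs\<in>index_words N b. p 0 vs * F' vs) = (\<Sum>j\<in>?J. length (c' j) * weight b (e' j))"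
        unfolding F'_def weight_def P'_def sum_distrib_left by (subst sum.swap) (simp add: mult_ac)
      also have "\<dots> = (\<Sum>j\<in>?J. lam' j * length (c' j))"
        by (intro sum.cong) (auto simp: eigenvalue_eq_weight[OF 2(1)])
      finally show ?thesis using ILC_eq_huffman_cost[OF 2, of 1] ab by simp
    qed
    finally show ?thesis .
  qed
  finally show ?thesis .
qed

lemma ILC_nonneg:
  assumes "l \<ge> 1"
  shows "0 \<le> ILC M X N s 1 l"
proof -
  obtain lam e where sd: "spectral_decomposition l (ensemble_state M X N s l) lam e"
    using ensemble_spectral_decomposition by blast
  moreover obtain c where "huffman_code {1..CARD('d) ^ l} lam c"
    using huffman_code_exists[of "{1..CARD('d) ^ l}" lam] by (auto simp: Suc_le_eq)
  ultimately have "ILC M X N s 1 l = (\<Sum>i = 1..CARD('d) ^ l. lam i * length (c i))"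
    using ILC_eq_huffman_cost[OF _ _ _ assms, of lam e c 1] by simp
  then show ?thesis using eigenvalue_nonneg[OF sd] by (auto intro!: sum_nonneg)
qed

lemma ILC_rate_eq_entropy_rate:
  "\<exists>h. (\<lambda>l. ILC M X N s 1 l / real l) \<longlonglongrightarrow> h \<and>
    (\<lambda>l. von_neumann_entropy l (ensemble_state M X N s l) / real l) \<longlonglongrightarrow> h"
proof -
  let ?S = "\<lambda>l. von_neumann_entropy l (ensemble_state M X N s l)"
  obtain h where h: "(\<lambda>l. ILC M X N s 1 l / real l) \<longlonglongrightarrow> h"
    by (rule fekete_subadditive_convergent[of "ILC M X N s 1"]) (use ILC_nonneg ILC_subadditive in auto)
  have "(\<lambda>l. (ILC M X N s 1 l - ?S l) / real l) \<longlonglongrightarrow> 0"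
  proof (rule tendsto_sandwich)
    show "\<forall>\<^sub>F l in sequentially. 0 \<le> (ILC M X N s 1 l - ?S l) / real l"
      using eventually_ge_at_top[of 1]
    proof eventually_elim
      case (elim l)
      then show ?case using ILC_near_entropy(1)[OF elim] by (intro divide_nonneg_nonneg) auto
    qed
    show "\<forall>\<^sub>F l in sequentially. (ILC M X N s 1 l - ?S l) / real l \<le> 2 / real l"
      using eventually_ge_at_top[of 1]
    proof eventually_elim
      case (elim l)
      then show ?case using ILC_near_entropy(2)[OF elim] by (intro divide_right_mono) auto
    qed
    show "(\<lambda>l. 2 / real l) \<longlonglongrightarrow> 0"
      by (intro tendsto_divide_0[OF tendsto_const] filterlim_at_top_imp_at_infinity filterlim_real_sequentially)
  qed simp
  then have "(\<lambda>l. ILC M X N s 1 l / real l - (ILC M X N s 1 l - ?S l) / real l) \<longlonglongrightarrow> h - 0"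
    by (intro tendsto_diff h)
  then have "(\<lambda>l. ?S l / real l) \<longlonglongrightarrow> h" by (simp add: diff_divide_distrib)
  then show ?thesis using h by blast
qed

end

theorem corollary3p2:
  fixes M :: "'w measure" and X :: "nat \<Rightarrow> 'w \<Rightarrow> nat" and N :: nat
    and s :: "nat \<Rightarrow> complex ^ 'd::finite"
  assumes "quantum_source M X N s"
    and "stationary_process M X N"
  shows "(\<forall>m\<ge>1. \<forall>l\<ge>1. \<forall>(lam :: nat \<Rightarrow> real) (e :: nat \<Rightarrow> 'd fock) (c :: nat \<Rightarrow> bool list).
            spectral_decomposition l (ensemble_state M X N s l) lam e \<longrightarrow>
            huffman_code {1..CARD('d) ^ l} lam c \<longrightarrow>
            constrained_special_block_code m l (\<lambda>k. string_isometry l c e) \<and>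
            avg_codeword_length M X N s m l (\<lambda>k. string_isometry l c e) = ILC M X N s m l)
       \<and> (\<exists>h. (\<lambda>l. ILC M X N s 1 l / real l) \<longlonglongrightarrow> h
            \<and> (\<lambda>l. von_neumann_entropy l (ensemble_state M X N s l) / real l) \<longlonglongrightarrow> h)"
proof -
  interpret stationary_source M X N s
    using assms by unfold_locales
  have "constrained_special_block_code m l (\<lambda>k. string_isometry l c e) \<and>
      avg_codeword_length M X N s m l (\<lambda>k. string_isometry l c e) = ILC M X N s m l"
    if "m \<ge> 1" "l \<ge> 1" "spectral_decomposition l (ensemble_state M X N s l) lam e"
      "huffman_code {1..CARD('d) ^ l} lam c" for m l lam c and e :: "nat \<Rightarrow> 'd fock"
    using that huffman_constrained_special_block_code[of l e lam c m]
      avg_codeword_length_huffman[of l lam e c m] ILC_eq_huffman_cost[of l lam e c m]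
    by (simp add: spectral_decomposition_def)
  then show ?thesis using ILC_rate_eq_entropy_rate by blast
qed

end
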